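(* Let $N\ge1$, $Z_0=z_0\in\mathbb{R}$, let $\tilde b,\tilde\beta,\tilde c,\tilde\gamma,\tilde\Gamma:\mathbb{R}^{N+1}\to\mathbb{R}$ be continuous, let $\mathsf{c}:\{(t,s):0\le s\le t<\infty\}\times\mathbb{R}^{N+1}\to\mathbb{R}^{N+1}$ be continuous, and let $\mathbf{v}(t)\in\mathbb{R}^{N+1}$ be the vector with components $\mathbf{v}(t)_i=\langle\bar{\mathbf{Z}}_0,\mathsf{c}(t,0,e_i)\rangle$, $i=0,\dots,N$, where $\bar{\mathbf{Z}}_t=(1,Z_t,\dots,Z_t^N)^\top$ and $(e_0,\dots,e_N)$ is the canonical basis of $\mathbb{R}^{N+1}$. Consider the SDE $$dZ_t=\big(\tilde b(\mathbf{v}(t))+\tilde\beta(\mathbf{v}(t))Z_t\big)dt+\sqrt{\tilde c(\mathbf{v}(t))+\tilde\gamma(\mathbf{v}(t))Z_t+\tilde\Gamma(\mathbf{v}(t))Z_t^2}\,dW_t,\qquad Z_0=z_0.\qquad( * )$$ Assume that a unique solution to the martingale problem associated with $( * )$ exists and that the maps $\mathsf{c}(\cdot)$ are the unique solution to the ODEs $$\frac{d}{dt}\big(\mathsf{c}(t,0,e_0),\dots,\mathsf{c}(t,0,e_N)\big)=\big(\mathsf{c}(t,0,e_0),\dots,\mathsf{c}(t,0,e_N)\big)\cdot\tilde{\mathbf{H}}(\mathbf{v}(t)),\qquad \mathsf{c}(0,0,e_i)=e_i,$$ $$\frac{d}{dt}\big(\mathsf{c}(T,t,e_0),\dots,\mathsf{c}(T,t,e_N)\big)=-\tilde{\mathbf{H}}(\mathbf{v}(t))\cdot\big(\mathsf{c}(T,t,e_0),\dots,\mathsf{c}(T,t,e_N)\big),\qquad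 \mathsf{c}(T,T,e_i)=e_i,$$ where $\big(\mathsf{c}(t,s,e_0),\dots,\mathsf{c}(t,s,e_N)\big)$ is the matrix with these columns and, for $v\in\mathbb{R}^{N+1}$ and $j,k=0,\dots,N$, $$\tilde{\mathbf{H}}(v)_{kj}=\begin{cases}j\tilde\beta(v)+\frac{j(j-1)}2\tilde\Gamma(v)&k=j,\ j\ne0\\ j\,\tilde b(v)+\frac{j(j-1)}2\tilde\gamma(v)&j=k+1\\ \frac{j(j-1)}2\tilde c(v)&j=k+2\\0&\text{else.}\end{cases}$$ For $u=(u_0,\dots,u_N)^\top\in\mathbb{R}^{N+1}$ set $\mathsf{c}(t,s,u):=\sum_{i=0}^Nu_i\,\mathsf{c}(t,s,e_i)$ for $0\le s\le t\le T$. Then, for all $T\ge0$ and all $u\in\mathbb{R}^{N+1}$, $\mathcal{M}_t:=\langle\bar{\mathbf{Z}}_t,\mathsf{c}(T,t,u)\rangle$ is a martingale on $[0,T]$, and therefore $$\mathbb{E}[\mathcal{M}_T|\mathcal{F}_t]=\mathbb{E}[\langle\bar{\mathbf{Z}}_T,u\rangle|\mathcal{F}_t]=\langle\bar{\mathbf{Z}}_t,\mathsf{c}(T,t,u)\rangle.$$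
   Context: The martingale problem associated with $( * )$: the coefficients of $( * )$ are deterministic functions of time and $Z_t$, say drift $B(t,z)$ and squared diffusion $\Sigma^2(t,z)$. A process $(t,Z_t)_{t\ge0}$ solves it if $\tau(t)f(Z_t)-\int_0^t\big(\tau(s)[B(s,Z_s)f'(Z_s)+\frac12\Sigma^2(s,Z_s)f''(Z_s)]+\tau'(s)f(Z_s)\big)ds$ is a martingale for all $\tau\in C_c^1([0,\infty))$ and all $f$ smooth with compact support on the state space. $W$ is a one-dimensional Brownian motion and $(\mathcal{F}_t)$ the underlying filtration. *)

theory Defs
  imports "HOL-Probability.Probability"
begin

section \<open>Martingales in continuous time\<close>

locale filtered_prob_space =
  prob_space M + filtration "space M" F
  for M :: "'a measure" and F :: "real \<Rightarrow> 'a measure" +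
  assumes subalgebra_F: "\<And>t. subalgebra M (F t)"

text \<open>
  Time is real because the library's filtrations are indexed by a whole type. Only the times
  \<open>t \<ge> 0\<close> matter; a filtration on \<open>{0..}\<close> is extended by \<open>F t = F 0\<close> for \<open>t < 0\<close>.
\<close>

definition martingale_on ::
  "'a measure \<Rightarrow> (real \<Rightarrow> 'a measure) \<Rightarrow> real set \<Rightarrow> (real \<Rightarrow> 'a \<Rightarrow> real) \<Rightarrow> bool" where
  "martingale_on M F I X \<longleftrightarrow>
     (\<forall>t\<in>I. X t \<in> borel_measurable (F t) \<and> integrable M (X t)) \<and>
     (\<forall>s\<in>I. \<forall>t\<in>I. s \<le> t \<longrightarrow> (AE \<omega> in M. real_cond_exp M (F s) (X t) \<omega> = X s \<omega>))"

section \<open>Test functions\<close>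

definition smooth_compact_support :: "(real \<Rightarrow> real) \<Rightarrow> bool" where
  "smooth_compact_support f \<longleftrightarrow>
     (\<forall>n. (deriv ^^ n) f differentiable_on UNIV) \<and> compact (closure {x. f x \<noteq> 0})"

text \<open>
  \<open>C1c_with_deriv \<tau> \<tau>'\<close>: \<open>\<tau> \<in> C\<^sub>c\<^sup>1([0,\<infinity>))\<close> with derivative \<open>\<tau>'\<close>, one-sided at \<open>0\<close>;
  \<open>\<tau> 0\<close> need not vanish.
\<close>

definition C1c_with_deriv :: "(real \<Rightarrow> real) \<Rightarrow> (real \<Rightarrow> real) \<Rightarrow> bool" where
  "C1c_with_deriv \<tau> \<tau>' \<longleftrightarrow>
     (\<forall>t\<ge>0. (\<tau> has_real_derivative \<tau>' t) (at t within {0..})) \<and>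
     continuous_on {0..} \<tau>' \<and>
     compact (closure {t\<in>{0..}. \<tau> t \<noteq> 0})"

section \<open>The martingale problem of a one-dimensional time-inhomogeneous SDE\<close>

text \<open>
  \<open>B t z\<close> is the drift, \<open>S t z\<close> the \<^emph>\<open>squared\<close> diffusion coefficient, the state space is the real
  line. As solutions of SDEs driven by a Brownian motion, solutions have continuous paths.
\<close>

definition solves_martingale_problem ::
  "(real \<Rightarrow> real \<Rightarrow> real) \<Rightarrow> (real \<Rightarrow> real \<Rightarrow> real) \<Rightarrow> real \<Rightarrow>
   'a measure \<Rightarrow> (real \<Rightarrow> 'a measure) \<Rightarrow> (real \<Rightarrow> 'a \<Rightarrow> real) \<Rightarrow> bool" where
  "solves_martingale_problem B S z0 M F Z \<longleftrightarrow>
     filtered_prob_space M F \<and>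
     (\<forall>t\<ge>0. Z t \<in> borel_measurable (F t)) \<and>
     (\<forall>\<omega>\<in>space M. continuous_on {0..} (\<lambda>t. Z t \<omega>)) \<and>
     (AE \<omega> in M. Z 0 \<omega> = z0) \<and>
     (\<forall>\<tau> \<tau>' f. C1c_with_deriv \<tau> \<tau>' \<longrightarrow> smooth_compact_support f \<longrightarrow>
        martingale_on M F {0..} (\<lambda>t \<omega>. \<tau> t * f (Z t \<omega>) -
          (LINT s:{0..t}|lborel.
             \<tau> s * (B s (Z s \<omega>) * deriv f (Z s \<omega>) + 1/2 * S s (Z s \<omega>) * deriv (deriv f) (Z s \<omega>))
             + \<tau>' s * f (Z s \<omega>))))"

text \<open>
  Well-posedness is existence and uniqueness in law. Laws are measures on the canonical space of
  continuous paths (extensional functions on \<open>{0..}\<close>), under which the coordinate process solves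
  the problem with respect to its own filtration.
\<close>

definition path_space :: "(real \<Rightarrow> real) measure" where
  "path_space = restrict_space (Pi\<^sub>M {0..} (\<lambda>_. borel)) {w. continuous_on {0..} w}"

definition path_filtration :: "real \<Rightarrow> (real \<Rightarrow> real) measure" where
  "path_filtration t =
     vimage_algebra (space path_space) (\<lambda>w. restrict w {0..t}) (Pi\<^sub>M {0..t} (\<lambda>_. borel))"

definition martingale_problem_well_posed ::
  "(real \<Rightarrow> real \<Rightarrow> real) \<Rightarrow> (real \<Rightarrow> real \<Rightarrow> real) \<Rightarrow> real \<Rightarrow> bool" where
  "martingale_problem_well_posed B S z0 \<longleftrightarrow>
     (\<exists>!P. sets P = sets path_space \<and>
           solves_martingale_problem B S z0 P path_filtration (\<lambda>t w. w t))"

section \<open>The dual ODEs\<close>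

text \<open>
  The space of vectors indexed by \<open>0,\<dots>,N\<close> is \<open>Euclidean_space (Suc N)\<close>: sequences vanishing
  beyond \<open>N\<close>.
\<close>

definition unit_vec :: "nat \<Rightarrow> nat \<Rightarrow> real" where
  "unit_vec i = (\<lambda>k. if k = i then 1 else 0)"

text \<open>\<open>moment_pairing N z u\<close> is the inner product of \<open>(1, z, \<dots>, z^N)\<close> with \<open>u\<close>.\<close>

definition moment_pairing :: "nat \<Rightarrow> real \<Rightarrow> (nat \<Rightarrow> real) \<Rightarrow> real" where
  "moment_pairing N z u = (\<Sum>i\<le>N. z ^ i * u i)"

text \<open>Below, \<open>c t s u\<close> is the map \<open>c(t, s, u)\<close>, used only for \<open>0 \<le> s \<le> t\<close>.\<close>

definition moment_vec ::
  "nat \<Rightarrow> real \<Rightarrow> (real \<Rightarrow> real \<Rightarrow> (nat \<Rightarrow> real) \<Rightarrow> nat \<Rightarrow> real) \<Rightarrow> real \<Rightarrow> nat \<Rightarrow> real" where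
  "moment_vec N z0 c t = (\<lambda>i. if i \<le> N then moment_pairing N z0 (c t 0 (unit_vec i)) else 0)"

definition linear_ext ::
  "nat \<Rightarrow> (real \<Rightarrow> real \<Rightarrow> (nat \<Rightarrow> real) \<Rightarrow> nat \<Rightarrow> real) \<Rightarrow>
   real \<Rightarrow> real \<Rightarrow> (nat \<Rightarrow> real) \<Rightarrow> nat \<Rightarrow> real" where
  "linear_ext N c t s u = (\<lambda>k. \<Sum>i\<le>N. u i * c t s (unit_vec i) k)"

definition continuous_coeff :: "nat \<Rightarrow> ((nat \<Rightarrow> real) \<Rightarrow> real) \<Rightarrow> bool" where
  "continuous_coeff N g \<longleftrightarrow> continuous_map (Euclidean_space (Suc N)) euclideanreal g"

definition continuous_flow ::
  "nat \<Rightarrow> (real \<Rightarrow> real \<Rightarrow> (nat \<Rightarrow> real) \<Rightarrow> nat \<Rightarrow> real) \<Rightarrow> bool" where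
  "continuous_flow N c \<longleftrightarrow>
     continuous_map
       (prod_topology (top_of_set {(t, s). 0 \<le> s \<and> s \<le> t}) (Euclidean_space (Suc N)))
       (Euclidean_space (Suc N))
       (\<lambda>((t, s), u). c t s u)"

definition H_matrix ::
  "((nat \<Rightarrow> real) \<Rightarrow> real) \<Rightarrow> ((nat \<Rightarrow> real) \<Rightarrow> real) \<Rightarrow> ((nat \<Rightarrow> real) \<Rightarrow> real) \<Rightarrow>
   ((nat \<Rightarrow> real) \<Rightarrow> real) \<Rightarrow> ((nat \<Rightarrow> real) \<Rightarrow> real) \<Rightarrow> (nat \<Rightarrow> real) \<Rightarrow> nat \<Rightarrow> nat \<Rightarrow> real" where
  "H_matrix b \<beta> a \<gamma> \<Gamma> v k j =
     (if k = j \<and> j \<noteq> 0 then real j * \<beta> v + real j * (real j - 1) / 2 * \<Gamma> v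
      else if j = k + 1 then real j * b v + real j * (real j - 1) / 2 * \<gamma> v
      else if j = k + 2 then real j * (real j - 1) / 2 * a v
      else 0)"

text \<open>
  \<open>c t s (unit_vec j) k\<close> is the entry in row \<open>k\<close>, column \<open>j\<close> of the matrix with columns
  \<open>c(t, s, e\<^sub>0), \<dots>, c(t, s, e\<^sub>N)\<close>. The matrix function \<open>H\<close> is evaluated at \<open>moment_vec\<close>, which
  itself depends on \<open>c\<close>.
\<close>

definition solves_dual_odes ::
  "nat \<Rightarrow> real \<Rightarrow> ((nat \<Rightarrow> real) \<Rightarrow> nat \<Rightarrow> nat \<Rightarrow> real) \<Rightarrow>
   (real \<Rightarrow> real \<Rightarrow> (nat \<Rightarrow> real) \<Rightarrow> nat \<Rightarrow> real) \<Rightarrow> bool" where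
  "solves_dual_odes N z0 H c \<longleftrightarrow>
     (\<forall>j\<le>N. c 0 0 (unit_vec j) = unit_vec j) \<and>
     (\<forall>t\<ge>0. \<forall>j\<le>N. \<forall>k\<le>N.
        ((\<lambda>t. c t 0 (unit_vec j) k) has_real_derivative
           (\<Sum>l\<le>N. c t 0 (unit_vec l) k * H (moment_vec N z0 c t) l j)) (at t within {0..})) \<and>
     (\<forall>T\<ge>0. \<forall>j\<le>N. c T T (unit_vec j) = unit_vec j) \<and>
     (\<forall>T\<ge>0. \<forall>t\<in>{0..T}. \<forall>j\<le>N. \<forall>k\<le>N.
        ((\<lambda>t. c T t (unit_vec j) k) has_real_derivative
           - (\<Sum>l\<le>N. H (moment_vec N z0 c t) k l * c T t (unit_vec j) l)) (at t within {0..T}))"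

text \<open>The equations only involve the vectors \<open>c(t, s, e\<^sub>i)\<close>, so uniqueness concerns these.\<close>

definition unique_solution_dual_odes ::
  "nat \<Rightarrow> real \<Rightarrow> ((nat \<Rightarrow> real) \<Rightarrow> nat \<Rightarrow> nat \<Rightarrow> real) \<Rightarrow>
   (real \<Rightarrow> real \<Rightarrow> (nat \<Rightarrow> real) \<Rightarrow> nat \<Rightarrow> real) \<Rightarrow> bool" where
  "unique_solution_dual_odes N z0 H c \<longleftrightarrow>
     solves_dual_odes N z0 H c \<and>
     (\<forall>c'. continuous_flow N c' \<longrightarrow> solves_dual_odes N z0 H c' \<longrightarrow>
        (\<forall>t s. 0 \<le> s \<longrightarrow> s \<le> t \<longrightarrow> (\<forall>i\<le>N. c' t s (unit_vec i) = c t s (unit_vec i))))"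

end

theory Submission
  imports Defs
begin

text \<open>
  Fix \<open>s \<le> T\<close> and an event \<open>A\<close> of \<open>F s\<close>. The generator maps monomials of degree at most \<open>N\<close> to
  polynomials of degree at most \<open>N\<close>, with matrix \<open>H\<close>; so the partial moments
  \<open>m k t = E[1_A Z_t^k]\<close> satisfy the linear ODE \<open>m' = H^T m\<close>, while the backward dual ODE reads
  \<open>c' = - H c\<close>. Hence \<open>\<Sum>k. m k t * c k t\<close> is constant on \<open>{s..T}\<close>, which is the martingale
  property tested on \<open>A\<close>.

  The analytic work is to pass from compactly supported test functions to monomials. Multiplying
  \<open>f\<close> by rescaled bump functions extends Dynkin's formula to all \<open>f\<close> for which \<open>f\<close>,
  \<open>(1 + \<bar>z\<bar>) f'\<close> and \<open>(1 + z^2) f''\<close> are dominated by a function \<open>w\<close> with \<open>E[w(Z_t)]\<close> bounded. This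
  applies to regularised powers of \<open>1 + z^2\<close> with constant \<open>w\<close>, giving moment bounds by Gronwall,
  and these bounds make monomials admissible.
\<close>

section \<open>Smooth functions\<close>

text \<open>Asking for some derivative at each stage, instead of iterating \<open>deriv\<close>,
  turns closure under sums, products, composition and inverses into inductions on the order;
  \<open>smooth_deriv\<close> leads back to \<open>deriv\<close>.\<close>

primrec times_differentiable :: "nat \<Rightarrow> (real \<Rightarrow> real) \<Rightarrow> bool" where
  "times_differentiable 0 f \<longleftrightarrow> True"
| "times_differentiable (Suc n) f \<longleftrightarrow>
     (\<exists>f'. (\<forall>x. (f has_real_derivative f' x) (at x)) \<and> times_differentiable n f')"

definition smooth :: "(real \<Rightarrow> real) \<Rightarrow> bool" where
  "smooth f \<longleftrightarrow> (\<forall>n. times_differentiable n f)"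

lemma times_differentiable_SucD: "times_differentiable (Suc n) f \<Longrightarrow> times_differentiable n f"
  by (induction n arbitrary: f) (simp, force)

lemma times_differentiable_SucI:
  assumes "\<And>x. (f has_real_derivative f' x) (at x)" "times_differentiable n f'"
  shows "times_differentiable (Suc n) f"
  using assms by auto

lemma times_differentiable_const: "times_differentiable n (\<lambda>x. c)"
proof (induction n arbitrary: c)
  case (Suc n)
  show ?case by (rule times_differentiable_SucI[where f' = "\<lambda>_. 0"]) (auto simp: Suc)
qed simp

lemma times_differentiable_ident: "times_differentiable n (\<lambda>x. x)"
  by (cases n) (use times_differentiable_const[of _ 1] in \<open>auto intro!: exI[of _ "\<lambda>_. 1"]\<close>)

lemma times_differentiable_add:
  "times_differentiable n f \<Longrightarrow> times_differentiable n g \<Longrightarrow> times_differentiable n (\<lambda>x. f x + g x)"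
proof (induction n arbitrary: f g)
  case (Suc n)
  then obtain f' g' where "\<And>x. (f has_real_derivative f' x) (at x)" "times_differentiable n f'"
      "\<And>x. (g has_real_derivative g' x) (at x)" "times_differentiable n g'"
    by auto
  with Suc.IH show ?case
    by (intro times_differentiable_SucI[where f' = "\<lambda>x. f' x + g' x"]) (auto intro!: derivative_intros)
qed simp

lemma times_differentiable_mult:
  "times_differentiable n f \<Longrightarrow> times_differentiable n g \<Longrightarrow> times_differentiable n (\<lambda>x. f x * g x)"
proof (induction n arbitrary: f g)
  case (Suc n)
  then obtain f' g' where "\<And>x. (f has_real_derivative f' x) (at x)" "times_differentiable n f'"
      "\<And>x. (g has_real_derivative g' x) (at x)" "times_differentiable n g'"
    by auto
  moreover have "times_differentiable n f" "times_differentiable n g"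
    using Suc.prems times_differentiable_SucD by auto
  ultimately show ?case
    by (intro times_differentiable_SucI[where f' = "\<lambda>x. f' x * g x + g' x * f x"]
        times_differentiable_add Suc.IH) (auto intro!: DERIV_mult)
qed simp

lemma times_differentiable_compose:
  "times_differentiable n f \<Longrightarrow> times_differentiable n g \<Longrightarrow> times_differentiable n (\<lambda>x. f (g x))"
proof (induction n arbitrary: f g)
  case (Suc n)
  then obtain f' g' where "\<And>x. (f has_real_derivative f' x) (at x)" "times_differentiable n f'"
      "\<And>x. (g has_real_derivative g' x) (at x)" "times_differentiable n g'"
    by auto
  moreover have "times_differentiable n g"
    using Suc.prems times_differentiable_SucD by auto
  ultimately show ?case
    using Suc.IH[of f' g]
    by (intro times_differentiable_SucI[where f' = "\<lambda>x. f' (g x) * g' x"]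
        times_differentiable_mult DERIV_chain2) blast+
qed simp

lemma times_differentiable_inverse:
  "times_differentiable n g \<Longrightarrow> (\<And>x. g x \<noteq> 0) \<Longrightarrow> times_differentiable n (\<lambda>x. inverse (g x))"
proof (induction n arbitrary: g)
  case (Suc n)
  then obtain g' where g': "\<And>x. (g has_real_derivative g' x) (at x)" "times_differentiable n g'"
    by auto
  have "times_differentiable n (\<lambda>x. inverse (g x))"
    using Suc times_differentiable_SucD by auto
  \<comment> \<open>The sign is written as a factor -1, so that closure under products covers
    it.\<close>
  then have "times_differentiable n (\<lambda>x. (- 1) * (inverse (g x) * g' x * inverse (g x)))"
    using g' by (intro times_differentiable_mult times_differentiable_const) auto
  with g' Suc.prems show ?case
    by (intro times_differentiable_SucI[where f' = "\<lambda>x. - (inverse (g x) * g' x * inverse (g x))"])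
       (auto intro!: DERIV_inverse')
qed simp

lemma smooth_const: "smooth (\<lambda>x. c)"
  by (simp add: smooth_def times_differentiable_const)

lemma smooth_ident: "smooth (\<lambda>x. x)"
  by (simp add: smooth_def times_differentiable_ident)

lemma smooth_add: "smooth f \<Longrightarrow> smooth g \<Longrightarrow> smooth (\<lambda>x. f x + g x)"
  by (simp add: smooth_def times_differentiable_add)

lemma smooth_mult: "smooth f \<Longrightarrow> smooth g \<Longrightarrow> smooth (\<lambda>x. f x * g x)"
  by (simp add: smooth_def times_differentiable_mult)

lemma smooth_compose: "smooth f \<Longrightarrow> smooth g \<Longrightarrow> smooth (\<lambda>x. f (g x))"
  by (simp add: smooth_def times_differentiable_compose)

lemma smooth_inverse: "smooth f \<Longrightarrow> (\<And>x. f x \<noteq> 0) \<Longrightarrow> smooth (\<lambda>x. inverse (f x))"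
  by (simp add: smooth_def times_differentiable_inverse)

lemma smooth_power: "smooth f \<Longrightarrow> smooth (\<lambda>x. f x ^ n)"
  by (induction n) (simp_all add: smooth_const smooth_mult)

lemmas smooth_intros =
  smooth_const smooth_ident smooth_add smooth_mult smooth_power smooth_inverse

text \<open>By uniqueness of derivatives, the derivative obtained at each order is the same function
  \<open>deriv f\<close>, which is therefore differentiable to every order.\<close>

lemma smooth_deriv:
  assumes "smooth f"
  shows "(f has_real_derivative deriv f x) (at x)" "smooth (deriv f)"
proof -
  have *: "\<exists>f'. (\<forall>x. (f has_real_derivative f' x) (at x)) \<and> times_differentiable n f'" for n
    using assms unfolding smooth_def by (metis times_differentiable.simps(2))
  have D: "f' = deriv f" if "\<forall>x. (f has_real_derivative f' x) (at x)" for f'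
    using that by (auto simp: fun_eq_iff intro!: DERIV_imp_deriv[symmetric])
  show "(f has_real_derivative deriv f x) (at x)" "smooth (deriv f)"
    using * D unfolding smooth_def by metis+
qed

lemma smooth_imp_continuous_on: "smooth f \<Longrightarrow> continuous_on A f"
  by (meson DERIV_continuous_on has_field_derivative_at_within smooth_deriv(1))

section \<open>Functions of compact support\<close>

lemma smooth_imp_smooth_compact_support:
  assumes "smooth f" "\<And>x. \<bar>x\<bar> > R \<Longrightarrow> f x = 0"
  shows "smooth_compact_support f"
proof -
  have "smooth ((deriv ^^ n) f)" for n
    by (induction n) (simp_all add: assms smooth_deriv)
  then have "(deriv ^^ n) f differentiable_on UNIV" for n
    by (meson differentiable_at_imp_differentiable_on real_differentiable_def smooth_deriv(1))
  moreover have "{x. f x \<noteq> 0} \<subseteq> {-R..R}"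
    using assms(2) by (fastforce simp flip: not_less)
  then have "compact (closure {x. f x \<noteq> 0})"
    using bounded_subset[OF bounded_closed_interval] by (simp add: compact_closure)
  ultimately show ?thesis unfolding smooth_compact_support_def by auto
qed

text \<open>The region \<open>\<bar>x\<bar> > R\<close> is open, so near \<open>x\<close> the
  function agrees with 0 and uniqueness of the derivative applies.\<close>

lemma deriv_eq_0_outside:
  fixes f :: "real \<Rightarrow> real"
  assumes "(f has_real_derivative D) (at x)" "\<And>x. \<bar>x\<bar> > R \<Longrightarrow> f x = 0" "\<bar>x\<bar> > R"
  shows "D = 0"
proof -
  have "((\<lambda>x. 0) has_real_derivative D) (at x)"
    using assms by (intro has_field_derivative_transform_within_open[OF assms(1),
          where S = "- cball 0 R"]) auto
  then show ?thesis by (rule DERIV_unique[OF _ DERIV_const])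
qed

lemma continuous_compact_support_bounded:
  fixes g :: "real \<Rightarrow> real"
  assumes "continuous_on UNIV g" and zero: "\<And>x. \<bar>x\<bar> > R \<Longrightarrow> g x = 0"
  shows "\<exists>K\<ge>0. \<forall>x. \<bar>g x\<bar> \<le> K"
proof -
  have "bounded (g ` {-R..R})"
    using assms by (intro compact_imp_bounded compact_continuous_image) (auto intro: continuous_on_subset)
  then obtain K where K: "\<And>x. \<bar>x\<bar> \<le> R \<Longrightarrow> \<bar>g x\<bar> \<le> K"
    by (force simp: bounded_iff abs_le_iff)
  then have "\<bar>g x\<bar> \<le> max 0 K" for x
    using K[of x] zero[of x] by (cases "\<bar>x\<bar> \<le> R") (auto simp: le_max_iff_disj)
  then show ?thesis by (intro exI[of _ "max 0 K"]) auto
qed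

section \<open>A smooth bump function\<close>

lemma poly_inverse_exp_tendsto_0:
  fixes p :: "real poly"
  shows "((\<lambda>x. poly p (1 / x) * exp (- (1 / x))) \<longlongrightarrow> 0) (at_right 0)"
proof -
  \<comment> \<open>With y = 1 / x the claim becomes the decay of a polynomial times exp(-y) at
    infinity.\<close>
  have "((\<lambda>y. poly p y * exp (- y)) \<longlongrightarrow> 0) at_top"
  proof -
    have "((\<lambda>y. \<Sum>i\<le>degree p. coeff p i * (y ^ i / exp y)) \<longlongrightarrow> (\<Sum>i\<le>degree p. coeff p i * 0)) at_top"
      by (intro tendsto_intros tendsto_power_div_exp_0)
    then show ?thesis
      by (simp add: poly_altdef sum_distrib_right exp_minus divide_inverse mult.assoc)
  qed
  then show ?thesis
    using filterlim_inverse_at_top_right filterlim_compose unfolding inverse_eq_divide by fast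
qed

text \<open>Differentiation maps this family into itself, replacing p by X^2 (p - p'), so the
  induction closes once \<open>p\<close> is arbitrary. Only the origin needs a limit
  argument.\<close>

lemma times_differentiable_exp_inverse_poly:
  "times_differentiable n (\<lambda>x. if x \<le> 0 then 0 else poly p (1 / x) * exp (- (1 / x)))"
proof (induction n arbitrary: p)
  case (Suc n)
  define e where "e = (\<lambda>p (x::real). if x \<le> 0 then 0 else poly p (1 / x) * exp (- (1 / x)))"
  define q where "q = [:0, 0, 1:] * (p - pderiv p)"
  have "(e p has_real_derivative e q x) (at x)" for x
  proof -
    consider "x < 0" | "x > 0" | "x = 0" by linarith
    then show ?thesis
    proof cases
      case 1
      have "((\<lambda>x. 0) has_real_derivative e q x) (at x)" using 1 by (simp add: e_def)
      then show ?thesis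
        by (rule has_field_derivative_transform_within_open[where S = "{..<0}"])
           (use 1 in \<open>auto simp: e_def\<close>)
    next
      case 2
      have "((\<lambda>x. poly p (1 / x) * exp (- (1 / x))) has_real_derivative e q x) (at x)"
        using 2 by (auto simp: e_def q_def field_simps power2_eq_square
              intro!: derivative_eq_intros DERIV_chain2[OF poly_DERIV])
      then show ?thesis
        by (rule has_field_derivative_transform_within_open[where S = "{0<..}"])
           (use 2 in \<open>auto simp: e_def\<close>)
    next
      case 3
      \<comment> \<open>From the right, the difference quotient at 0 belongs to the same family,
        with polynomial X p; from the left it is 0.\<close>
      have "((\<lambda>h. e p h / h) \<longlongrightarrow> 0) (at_right 0)"
        using poly_inverse_exp_tendsto_0[of "[:0, 1:] * p"]
        by (rule tendsto_cong[THEN iffD1, rotated])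
           (auto simp: e_def eventually_at_right_less field_simps intro!: eventually_at_rightI[of 0 1])
      moreover have "((\<lambda>h. e p h / h) \<longlongrightarrow> 0) (at_left 0)"
        by (rule tendsto_eventually) (auto simp: e_def intro!: eventually_at_leftI[of "-1" 0])
      ultimately have "((\<lambda>h. e p h / h) \<longlongrightarrow> 0) (at 0)"
        by (simp add: filterlim_split_at)
      then show ?thesis
        using 3 by (simp add: DERIV_def e_def cong: if_cong)
    qed
  qed
  moreover have "times_differentiable n (e q)"
    using Suc[of q] by (simp add: e_def)
  ultimately have "times_differentiable (Suc n) (e p)"
    by (rule times_differentiable_SucI)
  then show ?case by (simp add: e_def)
qed simp

lemma smooth_bump_exists:
  obtains \<psi> :: "real \<Rightarrow> real"
  where "smooth \<psi>" "\<psi> 0 = 1" "\<And>x. \<bar>x\<bar> > 1 \<Longrightarrow> \<psi> x = 0"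
proof -
  define e where "e = (\<lambda>x::real. if x \<le> 0 then 0 else exp (- (1 / x)))"
  \<comment> \<open>The classical bump exp(1 - 1 / (1 - x^2)) on (-1, 1); the factor
    \<open>exp 1\<close> normalises its value at 0 to 1.\<close>
  define \<psi> where "\<psi> = (\<lambda>x. exp 1 * e (1 + (- 1) * x ^ 2))"
  have "times_differentiable n e" for n
    using times_differentiable_exp_inverse_poly[of n 1] by (simp add: e_def cong: if_cong)
  then have "smooth e"
    by (simp add: smooth_def)
  then have "smooth \<psi>"
    unfolding \<psi>_def
    by (rule smooth_mult[OF smooth_const smooth_compose]) (intro smooth_intros)
  moreover have "\<psi> 0 = 1"
    by (simp add: \<psi>_def e_def flip: exp_add)
  moreover have "\<psi> x = 0" if "\<bar>x\<bar> > 1" for x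
  proof -
    have "1 \<le> \<bar>x\<bar>\<^sup>2" using that by (intro one_le_power) auto
    then show ?thesis by (simp add: \<psi>_def e_def)
  qed
  ultimately show ?thesis by (rule that)
qed

section \<open>Weights for a function and its first two derivatives, and cutoffs\<close>

text \<open>The factors 1 + |z| and 1 + z^2 match the growth of the drift and of the squared
  diffusion coefficient, so a weight of \<open>f\<close> also bounds the generator of
  \<open>f\<close> up to a constant.\<close>

definition weight_for :: "(real \<Rightarrow> real) \<Rightarrow> (real \<Rightarrow> real) \<Rightarrow> bool" where
  "weight_for f w \<longleftrightarrow>
     (\<forall>z. \<bar>f z\<bar> \<le> w z \<and> (1 + \<bar>z\<bar>) * \<bar>deriv f z\<bar> \<le> w z \<and> (1 + z\<^sup>2) * \<bar>deriv (deriv f) z\<bar> \<le> w z)"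

lemma weight_for_nonneg: "weight_for f w \<Longrightarrow> 0 \<le> w z"
  unfolding weight_for_def using abs_ge_zero order_trans by blast

lemma smooth_deriv_mult:
  assumes "smooth f" "smooth g"
  shows "deriv (\<lambda>x. f x * g x) = (\<lambda>x. deriv f x * g x + f x * deriv g x)"
    and "deriv (deriv (\<lambda>x. f x * g x)) =
      (\<lambda>x. deriv (deriv f) x * g x + 2 * (deriv f x * deriv g x) + f x * deriv (deriv g) x)"
proof -
  note derivs = assms[THEN smooth_deriv(1)] assms[THEN smooth_deriv(2), THEN smooth_deriv(1)]
  show 1: "deriv (\<lambda>x. f x * g x) = (\<lambda>x. deriv f x * g x + f x * deriv g x)"
    by (rule ext, rule DERIV_imp_deriv) (rule derivative_eq_intros derivs refl | simp)+
  show "deriv (deriv (\<lambda>x. f x * g x)) =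
      (\<lambda>x. deriv (deriv f) x * g x + 2 * (deriv f x * deriv g x) + f x * deriv (deriv g) x)"
    unfolding 1
    by (rule ext, rule DERIV_imp_deriv) (rule derivative_eq_intros derivs refl | simp)+
qed

text \<open>Every Leibniz term is a product of two weighted bounds; the cross term uses 1 + z^2
  \<le> (1 + |z|)^2. The factor 4 = 1 + 2 + 1 counts the terms of the second derivative.\<close>

lemma weight_for_mult:
  assumes "smooth f" "smooth g" and f: "weight_for f u" and g: "weight_for g v"
  shows "weight_for (\<lambda>x. f x * g x) (\<lambda>x. 4 * (u x * v x))"
  unfolding weight_for_def
  unfolding smooth_deriv_mult(2)[OF assms(1,2)]
  unfolding smooth_deriv_mult(1)[OF assms(1,2)]
proof (intro allI conjI)
  fix z
  have f': "\<bar>f z\<bar> \<le> u z" "(1 + \<bar>z\<bar>) * \<bar>deriv f z\<bar> \<le> u z" "(1 + z\<^sup>2) * \<bar>deriv (deriv f) z\<bar> \<le> u z"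
    using f by (auto simp: weight_for_def)
  have g': "\<bar>g z\<bar> \<le> v z" "(1 + \<bar>z\<bar>) * \<bar>deriv g z\<bar> \<le> v z" "(1 + z\<^sup>2) * \<bar>deriv (deriv g) z\<bar> \<le> v z"
    using g by (auto simp: weight_for_def)
  have nonneg: "0 \<le> u z" "0 \<le> v z" "0 \<le> u z * v z"
    using weight_for_nonneg f g by auto
  have sq: "1 + z\<^sup>2 \<le> (1 + \<bar>z\<bar>) * (1 + \<bar>z\<bar>)"
    by (simp add: algebra_simps power2_eq_square flip: abs_mult)
  have p00: "\<bar>f z\<bar> * \<bar>g z\<bar> \<le> u z * v z"
    by (rule mult_mono[OF f'(1) g'(1) nonneg(1)]) simp
  have p10: "((1 + \<bar>z\<bar>) * \<bar>deriv f z\<bar>) * \<bar>g z\<bar> \<le> u z * v z"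
    by (rule mult_mono[OF f'(2) g'(1) nonneg(1)]) simp
  have p01: "\<bar>f z\<bar> * ((1 + \<bar>z\<bar>) * \<bar>deriv g z\<bar>) \<le> u z * v z"
    by (rule mult_mono[OF f'(1) g'(2) nonneg(1)]) simp
  have p20: "((1 + z\<^sup>2) * \<bar>deriv (deriv f) z\<bar>) * \<bar>g z\<bar> \<le> u z * v z"
    by (rule mult_mono[OF f'(3) g'(1) nonneg(1)]) simp
  have p02: "\<bar>f z\<bar> * ((1 + z\<^sup>2) * \<bar>deriv (deriv g) z\<bar>) \<le> u z * v z"
    by (rule mult_mono[OF f'(1) g'(3) nonneg(1)]) simp
  have p11: "((1 + \<bar>z\<bar>) * \<bar>deriv f z\<bar>) * ((1 + \<bar>z\<bar>) * \<bar>deriv g z\<bar>) \<le> u z * v z"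
    by (rule mult_mono[OF f'(2) g'(2) nonneg(1)]) simp
  have "(1 + z\<^sup>2) * (\<bar>deriv f z\<bar> * \<bar>deriv g z\<bar>)
      \<le> (1 + \<bar>z\<bar>) * (1 + \<bar>z\<bar>) * (\<bar>deriv f z\<bar> * \<bar>deriv g z\<bar>)"
    using sq by (intro mult_right_mono) auto
  also have "\<dots> \<le> u z * v z"
    using p11 by (simp add: mult_ac)
  finally have p11': "(1 + z\<^sup>2) * (\<bar>deriv f z\<bar> * \<bar>deriv g z\<bar>) \<le> u z * v z" .
  show "\<bar>f z * g z\<bar> \<le> 4 * (u z * v z)"
    unfolding abs_mult using p00 nonneg by linarith
  have "(1 + \<bar>z\<bar>) * \<bar>deriv f z * g z + f z * deriv g z\<bar>
      \<le> (1 + \<bar>z\<bar>) * (\<bar>deriv f z\<bar> * \<bar>g z\<bar> + \<bar>f z\<bar> * \<bar>deriv g z\<bar>)"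
    by (intro mult_left_mono order_trans[OF abs_triangle_ineq]) (auto simp: abs_mult)
  also have "\<dots> = ((1 + \<bar>z\<bar>) * \<bar>deriv f z\<bar>) * \<bar>g z\<bar> + \<bar>f z\<bar> * ((1 + \<bar>z\<bar>) * \<bar>deriv g z\<bar>)"
    by (simp add: algebra_simps)
  finally show "(1 + \<bar>z\<bar>) * \<bar>deriv f z * g z + f z * deriv g z\<bar> \<le> 4 * (u z * v z)"
    using p10 p01 nonneg by linarith
  have "\<bar>deriv (deriv f) z * g z + 2 * (deriv f z * deriv g z) + f z * deriv (deriv g) z\<bar>
      \<le> \<bar>deriv (deriv f) z\<bar> * \<bar>g z\<bar> + 2 * (\<bar>deriv f z\<bar> * \<bar>deriv g z\<bar>) + \<bar>f z\<bar> * \<bar>deriv (deriv g) z\<bar>"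
    unfolding abs_mult[symmetric] by linarith
  then have "(1 + z\<^sup>2) * \<bar>deriv (deriv f) z * g z + 2 * (deriv f z * deriv g z) + f z * deriv (deriv g) z\<bar>
      \<le> (1 + z\<^sup>2) * (\<bar>deriv (deriv f) z\<bar> * \<bar>g z\<bar> + 2 * (\<bar>deriv f z\<bar> * \<bar>deriv g z\<bar>)
          + \<bar>f z\<bar> * \<bar>deriv (deriv g) z\<bar>)"
    by (intro mult_left_mono) auto
  also have "\<dots> = ((1 + z\<^sup>2) * \<bar>deriv (deriv f) z\<bar>) * \<bar>g z\<bar> + 2 * ((1 + z\<^sup>2) * (\<bar>deriv f z\<bar> * \<bar>deriv g z\<bar>))
      + \<bar>f z\<bar> * ((1 + z\<^sup>2) * \<bar>deriv (deriv g) z\<bar>)"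
    by (simp add: algebra_simps)
  finally show "(1 + z\<^sup>2) * \<bar>deriv (deriv f) z * g z + 2 * (deriv f z * deriv g z) + f z * deriv (deriv g) z\<bar>
      \<le> 4 * (u z * v z)"
    using p20 p02 p11' by linarith
qed

text \<open>Each further factor costs 4 c by \<open>weight_for_mult\<close>; keeping c apart from p
  shows that the k-th power is controlled by p^k up to a constant.\<close>

lemma weight_for_power:
  assumes f: "smooth f" "weight_for f (\<lambda>x. c * p x)"
  shows "weight_for (\<lambda>x. f x ^ k) (\<lambda>x. (4 * c) ^ k * p x ^ k)"
proof (induction k)
  case 0
  show ?case by (simp add: weight_for_def)
next
  case (Suc k)
  from weight_for_mult[OF f(1) smooth_power[OF f(1)] f(2) this]
  show ?case by (simp add: mult_ac)
qed

text \<open>Both derivatives vanish outside the support as well, so the polynomial factors of the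
  weight only matter on a compact interval.\<close>

lemma weight_for_compact_support:
  assumes f: "smooth f" "\<And>x. \<bar>x\<bar> > R \<Longrightarrow> f x = 0"
  obtains K where "weight_for f (\<lambda>_. K)"
proof -
  have bounded: "\<exists>K. \<forall>z. \<bar>g z\<bar> \<le> K"
    if "continuous_on UNIV g" "\<And>x. \<bar>x\<bar> > R \<Longrightarrow> g x = 0" for g :: "real \<Rightarrow> real"
    using continuous_compact_support_bounded[OF that] by blast
  have d1: "deriv f x = 0" if "\<bar>x\<bar> > R" for x
    using deriv_eq_0_outside[OF smooth_deriv(1)[OF f(1)] f(2)] that by blast
  have d2: "deriv (deriv f) x = 0" if "\<bar>x\<bar> > R" for x
    using deriv_eq_0_outside[OF smooth_deriv(1)[OF smooth_deriv(2)[OF f(1)]] d1] that by blast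
  have cont: "continuous_on UNIV f" "continuous_on UNIV (deriv f)" "continuous_on UNIV (deriv (deriv f))"
    using f by (simp_all add: smooth_imp_continuous_on smooth_deriv)
  obtain K0 where "\<And>z. \<bar>f z\<bar> \<le> K0"
    using bounded[OF cont(1) f(2)] by blast
  moreover obtain K1 where "\<And>z. \<bar>(1 + \<bar>z\<bar>) * deriv f z\<bar> \<le> K1"
    using bounded[of "\<lambda>z. (1 + \<bar>z\<bar>) * deriv f z"] cont d1 by (force intro!: continuous_intros)
  moreover obtain K2 where "\<And>z. \<bar>(1 + z\<^sup>2) * deriv (deriv f) z\<bar> \<le> K2"
    using bounded[of "\<lambda>z. (1 + z\<^sup>2) * deriv (deriv f) z"] cont d2 by (force intro!: continuous_intros)
  ultimately have "weight_for f (\<lambda>_. max K0 (max K1 K2))"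
    unfolding weight_for_def by (auto simp: abs_mult le_max_iff_disj)
  then show ?thesis by (rule that)
qed

text \<open>
  Rescaling a bump \<open>\<psi> (x / R)\<close> costs a factor \<open>1 / R\<close> per derivative, which the bounded support
  \<open>\<bar>x\<bar> \<le> R\<close> turns into the uniform bounds below.
\<close>

lemma cutoff_sequence:
  obtains \<eta> :: "nat \<Rightarrow> real \<Rightarrow> real" and K :: real
  where "\<And>n. smooth (\<eta> n)" "\<And>n x. \<bar>x\<bar> > real (Suc n) \<Longrightarrow> \<eta> n x = 0"
    "\<And>n. weight_for (\<eta> n) (\<lambda>_. K)"
    "\<And>x. (\<lambda>n. \<eta> n x) \<longlonglongrightarrow> 1"
    "\<And>x. (\<lambda>n. deriv (\<eta> n) x) \<longlonglongrightarrow> 0"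
    "\<And>x. (\<lambda>n. deriv (deriv (\<eta> n)) x) \<longlonglongrightarrow> 0"
proof -
  obtain \<psi> :: "real \<Rightarrow> real" where \<psi>: "smooth \<psi>" "\<psi> 0 = 1" "\<And>x. \<bar>x\<bar> > 1 \<Longrightarrow> \<psi> x = 0"
    by (metis smooth_bump_exists)
  define d where "d = (\<lambda>j. (deriv ^^ j) \<psi>)"
  have d_smooth: "smooth (d j)" for j
    unfolding d_def by (induction j) (simp_all add: \<psi> smooth_deriv)
  have d_deriv: "(d j has_real_derivative d (Suc j) x) (at x)" for j x
    using smooth_deriv(1)[OF d_smooth[of j]] by (simp add: d_def)
  have d_zero: "d j x = 0" if "\<bar>x\<bar> > 1" for j x
    using that
  proof (induction j arbitrary: x)
    case (Suc j)
    show ?case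
      by (rule deriv_eq_0_outside[OF d_deriv Suc.IH]) (use Suc.prems in auto)
  qed (simp add: d_def \<psi>)
  have "\<exists>K\<ge>0. \<forall>x. \<bar>d j x\<bar> \<le> K" for j
    using smooth_imp_continuous_on[OF d_smooth] d_zero by (rule continuous_compact_support_bounded)
  then obtain K where K: "\<And>j. K j \<ge> 0" "\<And>j x. \<bar>d j x\<bar> \<le> K j" by metis
  \<comment> \<open>Scaling by n + 1 avoids a division by zero at index 0.\<close>
  define \<eta> where "\<eta> = (\<lambda>n x. \<psi> (1 / real (Suc n) * x))"
  have \<eta>_deriv_aux: "((\<lambda>x. d j (1 / real (Suc n) * x)) has_real_derivative
      1 / real (Suc n) * d (Suc j) (1 / real (Suc n) * x)) (at x)" for j n x
  proof -
    have "((\<lambda>x. 1 / real (Suc n) * x) has_real_derivative 1 / real (Suc n)) (at x)"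
      by (auto intro!: derivative_eq_intros simp del: of_nat_Suc)
    from DERIV_chain2[OF d_deriv this] show ?thesis by (simp only: mult.commute)
  qed
  have \<eta>1: "deriv (\<eta> n) = (\<lambda>x. 1 / real (Suc n) * d 1 (1 / real (Suc n) * x))" for n
    using \<eta>_deriv_aux[of 0 n] by (auto simp: \<eta>_def d_def fun_eq_iff intro!: DERIV_imp_deriv)
  have \<eta>2: "deriv (deriv (\<eta> n)) = (\<lambda>x. (1 / real (Suc n))\<^sup>2 * d 2 (1 / real (Suc n) * x))" for n
    unfolding \<eta>1 using DERIV_cmult[OF \<eta>_deriv_aux[of 1 n], of "1 / real (Suc n)"]
    by (auto simp: fun_eq_iff power2_eq_square mult.assoc numeral_2_eq_2 simp del: of_nat_Suc intro!: DERIV_imp_deriv)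
  have scaled: "w * \<bar>(1 / real (Suc n)) ^ i * d j (1 / real (Suc n) * x)\<bar> \<le> 2 * K j"
    if w: "\<bar>x\<bar> \<le> real (Suc n) \<Longrightarrow> w \<le> 2 * real (Suc n) ^ i" "w \<ge> 0" for n i j x w
  proof (cases "\<bar>x\<bar> \<le> real (Suc n)")
    case True
    have "w * \<bar>(1 / real (Suc n)) ^ i * d j (1 / real (Suc n) * x)\<bar>
        = (w / real (Suc n) ^ i) * \<bar>d j (1 / real (Suc n) * x)\<bar>"
      by (simp add: abs_mult power_divide del: of_nat_Suc)
    also have "\<dots> \<le> 2 * K j"
      using w True by (intro mult_mono K) (auto simp: field_simps simp del: of_nat_Suc)
    finally show ?thesis .
  next
    case False
    then have "d j (1 / real (Suc n) * x) = 0"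
      by (intro d_zero) (simp add: abs_mult field_simps)
    then show ?thesis using K by simp
  qed
  define L where "L = 2 * (K 0 + K 1 + K 2)"
  have L: "2 * K 0 \<le> L" "2 * K 1 \<le> L" "2 * K 2 \<le> L"
    using K(1)[of 0] K(1)[of 1] K(1)[of 2] by (auto simp: L_def)
  \<comment> \<open>At fixed x the rescaled argument tends to 0. The values of
    \<open>\<eta> n\<close> thus tend to \<open>\<psi> 0 = 1\<close>, while the prefactors 1 / (n +
    1) and 1 / (n + 1)^2 make the derivatives vanish in the limit.\<close>
  have lim: "(\<lambda>n. d j (1 / real (Suc n) * x)) \<longlonglongrightarrow> d j 0" for j x
  proof -
    have "(\<lambda>n. 1 / real (Suc n) * x) \<longlonglongrightarrow> 0 * x"
      using LIMSEQ_inverse_real_of_nat by (intro tendsto_intros) (simp add: inverse_eq_divide)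
    moreover have "isCont (d j) 0"
      using d_deriv DERIV_isCont by blast
    ultimately show ?thesis
      using isCont_tendsto_compose by fastforce
  qed
  have lim0: "(\<lambda>n. 1 / real (Suc n)) \<longlonglongrightarrow> 0"
    using LIMSEQ_inverse_real_of_nat by (simp add: inverse_eq_divide)
  show ?thesis
  proof (rule that[of \<eta> L])
    show "smooth (\<eta> n)" for n
      unfolding \<eta>_def by (rule smooth_compose[OF \<psi>(1)]) (intro smooth_intros)
    show "\<eta> n x = 0" if "\<bar>x\<bar> > real (Suc n)" for n x
      unfolding \<eta>_def using that by (intro \<psi>(3)) (simp add: abs_mult field_simps)
    have "\<bar>\<eta> n x\<bar> \<le> L" for n x
      using K(2)[of 0 "1 / real (Suc n) * x"] L K(1)[of 0] by (simp add: \<eta>_def d_def del: of_nat_Suc)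
    moreover have "(1 + \<bar>x\<bar>) * \<bar>deriv (\<eta> n) x\<bar> \<le> L" for n x
      using scaled[of x n "1 + \<bar>x\<bar>" 1 1] L by (simp add: \<eta>1)
    moreover have "(1 + x\<^sup>2) * \<bar>deriv (deriv (\<eta> n)) x\<bar> \<le> L" for n x
    proof -
      have "1 + x\<^sup>2 \<le> 2 * real (Suc n) ^ 2" if "\<bar>x\<bar> \<le> real (Suc n)"
      proof -
        have "x\<^sup>2 \<le> real (Suc n) ^ 2"
          using that by (metis abs_ge_zero power2_abs power_mono)
        moreover have "1 \<le> real (Suc n) ^ 2" by (rule one_le_power) simp
        ultimately show ?thesis by linarith
      qed
      then show ?thesis
        using scaled[of x n "1 + x\<^sup>2" 2 2] L by (simp add: \<eta>2 del: of_nat_Suc)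
    qed
    ultimately show "weight_for (\<eta> n) (\<lambda>_. L)" for n
      by (simp add: weight_for_def)
    show "(\<lambda>n. \<eta> n x) \<longlonglongrightarrow> 1" for x
      using lim[of 0 x] by (simp add: \<eta>_def d_def \<psi> del: of_nat_Suc)
    show "(\<lambda>n. deriv (\<eta> n) x) \<longlonglongrightarrow> 0" for x
      using tendsto_mult[OF lim0 lim[of 1 x]] by (simp add: \<eta>1 del: of_nat_Suc)
    show "(\<lambda>n. deriv (deriv (\<eta> n)) x) \<longlonglongrightarrow> 0" for x
      using tendsto_mult[OF tendsto_power[OF lim0, of 2] lim[of 2 x]] by (simp add: \<eta>2 del: of_nat_Suc)
  qed
qed

section \<open>Plateau functions and Gronwall's inequality\<close>

lemma has_real_derivative_max_0_squared:
  "((\<lambda>x::real. (max 0 x)\<^sup>2) has_real_derivative 2 * max 0 x) (at x)"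
proof -
  consider "x < 0" | "x > 0" | "x = 0" by linarith
  then show ?thesis
  proof cases
    case 1
    have "((\<lambda>x. 0) has_real_derivative 2 * max 0 x) (at x)" using 1 by simp
    then show ?thesis
      by (rule has_field_derivative_transform_within_open[where S = "{..<0}"]) (use 1 in auto)
  next
    case 2
    have "((\<lambda>x. x\<^sup>2) has_real_derivative 2 * max 0 x) (at x)"
      using 2 by (auto intro!: derivative_eq_intros)
    then show ?thesis
      by (rule has_field_derivative_transform_within_open[where S = "{0<..}"]) (use 2 in auto)
  next
    case 3
    have "((\<lambda>h::real. max 0 h) \<longlongrightarrow> max 0 0) (at 0)"
      by (intro tendsto_intros)
    then have "((\<lambda>h::real. max 0 h) \<longlongrightarrow> 0) (at 0)"
      by simp
    then have "((\<lambda>h::real. (max 0 h)\<^sup>2 / h) \<longlongrightarrow> 0) (at 0)"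
      by (rule tendsto_cong[THEN iffD1, rotated])
         (auto simp: max_def power2_eq_square eventually_at_filter)
    then show ?thesis using 3 by (simp add: DERIV_def)
  qed
qed

text \<open>A time function that is constantly 1 up to the horizon removes \<open>\<tau>\<close> and
  \<open>\<tau>'\<close> from the martingale problem on that interval.\<close>

lemma C1c_plateau:
  obtains \<tau> \<tau>' where "C1c_with_deriv \<tau> \<tau>'" "\<And>t. t \<le> T \<Longrightarrow> \<tau> t = 1" "\<And>t. t \<le> T \<Longrightarrow> \<tau>' t = 0"
proof -
  define p where "p = (\<lambda>x::real. (max 0 x)\<^sup>2)"
  \<comment> \<open>In terms of positive parts this is ((1 - ((t - T)_+)^2)_+)^2, which is 1 up to T
    and 0 from T + 1 on. Squared positive parts are continuously differentiable, which is all that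
    time functions require.\<close>
  define \<tau> where "\<tau> = (\<lambda>t. p (1 - p (t - T)))"
  define \<tau>' where "\<tau>' = (\<lambda>t. 2 * max 0 (1 - p (t - T)) * (- (2 * max 0 (t - T))))"
  have p: "(p has_real_derivative 2 * max 0 x) (at x)" for x
    using has_real_derivative_max_0_squared by (simp add: p_def)
  have "(\<tau> has_real_derivative \<tau>' t) (at t)" for t
    unfolding \<tau>_def \<tau>'_def
    by (rule derivative_eq_intros DERIV_chain2[OF p] refl | simp)+
  moreover have "continuous_on {0..} \<tau>'"
    unfolding \<tau>'_def p_def by (intro continuous_intros)
  moreover have "compact (closure {t\<in>{0..}. \<tau> t \<noteq> 0})"
  proof -
    have "\<tau> t = 0" if "t > T + 1" for t
    proof -
      have "1 \<le> (t - T)\<^sup>2" using that by (intro one_le_power) auto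
      then have "1 - p (t - T) \<le> 0" using that by (simp add: p_def max_def)
      then show ?thesis by (simp add: \<tau>_def p_def)
    qed
    then have "{t\<in>{0..}. \<tau> t \<noteq> 0} \<subseteq> {0..T + 1}"
      by (auto simp: not_less[symmetric])
    then show ?thesis
      using bounded_subset[OF bounded_closed_interval] by (simp add: compact_closure)
  qed
  ultimately have "C1c_with_deriv \<tau> \<tau>'"
    by (simp add: C1c_with_deriv_def has_field_derivative_at_within)
  moreover have "\<tau> t = 1" "\<tau>' t = 0" if "t \<le> T" for t
    using that by (simp_all add: \<tau>_def \<tau>'_def p_def)
  ultimately show ?thesis by (rule that)
qed

section \<open>Gronwall's inequality in integral form\<close>

lemma continuous_on_of_has_integral:
  fixes m h :: "real \<Rightarrow> real"
  assumes "\<And>t. t \<in> {s..T} \<Longrightarrow> (h has_integral (m t - m s)) {s..t}"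
  shows "continuous_on {s..T} m"
proof (cases "s \<le> T")
  case True
  have "continuous_on {s..T} (\<lambda>t. m s + integral {s..t} h)"
    using assms[of T] True by (intro continuous_intros indefinite_integral_continuous_1) auto
  then show ?thesis
    by (rule continuous_on_cong[THEN iffD1, rotated -1]) (simp_all add: integral_unique[OF assms])
qed simp

text \<open>Here \<open>m\<close> is only known as an indefinite integral of \<open>h\<close>, so
  the differential argument is run on the primitive \<open>\<phi>\<close> of the continuous function
  \<open>m\<close>.\<close>

lemma gronwall_integral:
  fixes m h :: "real \<Rightarrow> real"
  assumes h: "\<And>t. t \<in> {0..T} \<Longrightarrow> (h has_integral (m t - m 0)) {0..t}"
    and le: "\<And>t. t \<in> {0..T} \<Longrightarrow> h t \<le> C * m t" and C: "C \<ge> 0" and t: "t \<in> {0..T}"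
  shows "m t \<le> m 0 * exp (C * t)"
proof -
  have cont: "continuous_on {0..T} m"
    using h by (rule continuous_on_of_has_integral)
  define \<phi> where "\<phi> = (\<lambda>t. integral {0..t} m)"
  have m_le: "m r \<le> m 0 + C * \<phi> r" if "r \<in> {0..T}" for r
  proof -
    have "m integrable_on {0..r}"
      using that by (intro integrable_continuous_real continuous_on_subset[OF cont]) auto
    then have "((\<lambda>t. C * m t) has_integral C * \<phi> r) {0..r}"
      unfolding \<phi>_def by (intro has_integral_mult_right integrable_integral)
    from has_integral_le[OF h[OF that] this] that le show ?thesis by auto
  qed
  \<comment> \<open>The majorant y = m 0 + C \<phi> of m satisfies y' = C m \<le> C y, so y exp(-C
    t) does not increase.\<close>
  define \<theta> where "\<theta> = (\<lambda>t. (m 0 + C * \<phi> t) * exp (- C * t))"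
  have \<phi>_deriv: "(\<phi> has_real_derivative m r) (at r within {0..T})" if "r \<in> {0..T}" for r
    unfolding \<phi>_def using cont that by (rule integral_has_real_derivative)
  have "\<theta> t \<le> \<theta> 0"
  proof (rule DERIV_nonpos_imp_decreasing_open[where f = \<theta>])
    show "\<exists>y. (\<theta> has_real_derivative y) (at r) \<and> y \<le> 0" if r: "0 < r" "r < t" for r
    proof (intro exI conjI)
      have "(\<phi> has_real_derivative m r) (at r)"
        using \<phi>_deriv[of r] r t by (simp add: at_within_Icc_at)
      then show "(\<theta> has_real_derivative
          C * (m r - (m 0 + C * \<phi> r)) * exp (- C * r)) (at r)"
        unfolding \<theta>_def by (auto intro!: derivative_eq_intros simp: algebra_simps)
      show "C * (m r - (m 0 + C * \<phi> r)) * exp (- C * r) \<le> 0"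
        using m_le[of r] r t C by (auto simp: mult_nonneg_nonpos mult_nonpos_nonneg)
    qed
    have "continuous_on {0..T} \<phi>"
      using \<phi>_deriv DERIV_continuous_on by blast
    then show "continuous_on {0..t} \<theta>"
      unfolding \<theta>_def using t by (intro continuous_intros) (auto intro: continuous_on_subset)
  qed (use t in auto)
  then have "(m 0 + C * \<phi> t) * exp (- C * t) * exp (C * t) \<le> m 0 * exp (C * t)"
    by (intro mult_right_mono) (auto simp: \<theta>_def \<phi>_def)
  then show ?thesis
    using m_le[OF t] by (simp add: mult.assoc flip: exp_add)
qed

section \<open>Dynkin's formula for the martingale problem\<close>

text \<open>Integrating the almost sure identity over an event of the past gives the form of the
  martingale property on which all later computations rest.\<close>

lemma martingale_on_set_integral_eq:
  assumes "filtered_prob_space M F" and "martingale_on M F I X" "s \<in> I" "t \<in> I" "s \<le> t" "A \<in> sets (F s)"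
  shows "(LINT \<omega>:A|M. X t \<omega>) = (LINT \<omega>:A|M. X s \<omega>)"
proof -
  interpret filtered_prob_space M F by fact
  interpret finite_measure_subalgebra M "F s"
    by (simp add: finite_measure_subalgebra_def subalgebra_F finite_measure_axioms
        finite_measure_subalgebra_axioms_def)
  have A: "A \<in> sets M"
    using assms subalgebra_F unfolding subalgebra_def by blast
  have "X s \<in> borel_measurable M"
    using assms borel_measurable_integrable by (auto simp: martingale_on_def)
  have "(LINT \<omega>:A|M. X t \<omega>) = (LINT \<omega>:A|M. real_cond_exp M (F s) (X t) \<omega>)"
    using assms by (intro real_cond_exp_intA) (auto simp: martingale_on_def)
  also have "\<dots> = (LINT \<omega>:A|M. X s \<omega>)"
  proof -
    have "AE \<omega> in M. real_cond_exp M (F s) (X t) \<omega> = X s \<omega>"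
      using assms unfolding martingale_on_def by blast
    then have "AE \<omega> in M. indicator A \<omega> *\<^sub>R real_cond_exp M (F s) (X t) \<omega> = indicator A \<omega> *\<^sub>R X s \<omega>"
      by eventually_elim simp
    then show ?thesis
      using A \<open>X s \<in> _\<close> unfolding set_lebesgue_integral_def by (intro integral_cong_AE) auto
  qed
  finally show ?thesis .
qed

definition generator ::
  "(real \<Rightarrow> real \<Rightarrow> real) \<Rightarrow> (real \<Rightarrow> real \<Rightarrow> real) \<Rightarrow> (real \<Rightarrow> real) \<Rightarrow> real \<Rightarrow> real \<Rightarrow> real" where
  "generator B S f t z = B t z * deriv f z + 1/2 * S t z * deriv (deriv f) z"

text \<open>
  The process and the coefficients are extended to \<open>t < 0\<close>, so that continuity and joint
  measurability can be stated on the whole line.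
\<close>

locale continuous_martingale_problem = filtered_prob_space M F
  for M :: "'a measure" and F :: "real \<Rightarrow> 'a measure" +
  fixes B S :: "real \<Rightarrow> real \<Rightarrow> real" and z0 :: real and Z :: "real \<Rightarrow> 'a \<Rightarrow> real"
  assumes solves: "solves_martingale_problem B S z0 M F Z"
    and Z_nonpos: "t \<le> 0 \<Longrightarrow> Z t = Z 0"
    and continuous_coeffs: "continuous_on UNIV (\<lambda>(t, z). B t z)" "continuous_on UNIV (\<lambda>(t, z). S t z)"
    and growth: "\<exists>C. \<forall>t\<in>{0..T}. \<forall>z. \<bar>B t z\<bar> \<le> C * (1 + \<bar>z\<bar>) \<and> \<bar>S t z\<bar> \<le> C * (1 + z\<^sup>2)"
begin

section \<open>Measurability and path continuity of the process\<close>

lemma Z_adapted: "t \<ge> 0 \<Longrightarrow> Z t \<in> borel_measurable (F t)"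
  using solves by (simp add: solves_martingale_problem_def)

lemma Z_measurable [measurable]: "Z t \<in> borel_measurable M"
proof -
  have "Z (max 0 t) \<in> borel_measurable M"
    by (rule measurable_from_subalg[OF subalgebra_F Z_adapted]) simp
  moreover have "Z (max 0 t) = Z t"
    using Z_nonpos[of t] by (cases "t \<le> 0") auto
  ultimately show ?thesis by simp
qed

lemma Z_continuous: "\<omega> \<in> space M \<Longrightarrow> continuous_on UNIV (\<lambda>t. Z t \<omega>)"
proof -
  assume "\<omega> \<in> space M"
  then have "continuous_on {0..} (\<lambda>t. Z t \<omega>)"
    using solves by (simp add: solves_martingale_problem_def)
  then have "continuous_on UNIV (\<lambda>t. Z (max 0 t) \<omega>)"
    by (rule continuous_on_compose2) (auto intro!: continuous_intros)
  moreover have "Z (max 0 t) = Z t" for t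
    using Z_nonpos[of t] by (cases "t \<le> 0") auto
  ultimately show ?thesis by simp
qed

text \<open>By path continuity, Z is the pointwise limit of its discretisations on grids of mesh 1 /
  (n + 1). Each of these involves countably many times only. Joint measurability is what Fubini's
  theorem needs.\<close>

lemma Z_jointly_measurable [measurable]: "(\<lambda>(t, \<omega>). Z t \<omega>) \<in> borel_measurable (lborel \<Otimes>\<^sub>M M)"
proof (rule borel_measurable_LIMSEQ_real)
  define q where "q = (\<lambda>n t. real_of_int \<lfloor>t * real (Suc n)\<rfloor> / real (Suc n))"
  show "(\<lambda>(t, \<omega>). Z (q n t) \<omega>) \<in> borel_measurable (lborel \<Otimes>\<^sub>M M)" for n
  proof -
    have "(\<lambda>p. Z (real_of_int \<lfloor>fst p * real (Suc n)\<rfloor> / real (Suc n)) (snd p))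
        \<in> borel_measurable (lborel \<Otimes>\<^sub>M M)"
      by (rule measurable_compose_countable[where g = "\<lambda>p. \<lfloor>fst p * real (Suc n)\<rfloor>"]) measurable
    then show ?thesis by (simp add: q_def case_prod_beta)
  qed
  have q: "(\<lambda>n. q n t) \<longlonglongrightarrow> t" for t
  proof -
    have "\<bar>q n t - t\<bar> \<le> inverse (real (Suc n))" for n
    proof -
      have "q n t - t = (real_of_int \<lfloor>t * real (Suc n)\<rfloor> - t * real (Suc n)) / real (Suc n)"
        by (simp add: q_def diff_divide_distrib del: of_nat_Suc)
      moreover have "\<bar>real_of_int \<lfloor>t * real (Suc n)\<rfloor> - t * real (Suc n)\<bar> \<le> 1"
        by linarith
      ultimately show ?thesis
        by (simp add: divide_right_mono inverse_eq_divide del: of_nat_Suc)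
    qed
    then have "(\<lambda>n. q n t - t) \<longlonglongrightarrow> 0"
      by (intro Lim_null_comparison[OF _ LIMSEQ_inverse_real_of_nat]) auto
    then show ?thesis by (simp add: LIM_zero_iff)
  qed
  show "(\<lambda>n. (case p of (t, \<omega>) \<Rightarrow> Z (q n t) \<omega>)) \<longlonglongrightarrow> (case p of (t, \<omega>) \<Rightarrow> Z t \<omega>)"
    if "p \<in> space (lborel \<Otimes>\<^sub>M M)" for p
    using that continuous_on_tendsto_compose[OF Z_continuous q]
    by (auto simp: space_pair_measure)
qed

section \<open>Regularity and growth of the generator\<close>

lemma generator_continuous:
  assumes "smooth f"
  shows "continuous_on UNIV (\<lambda>(t, z). generator B S f t z)"
proof -
  have f: "continuous_on UNIV (deriv f)" "continuous_on UNIV (deriv (deriv f))"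
    using assms by (simp_all add: smooth_imp_continuous_on smooth_deriv)
  show ?thesis
    unfolding generator_def case_prod_beta
    using continuous_coeffs unfolding case_prod_beta
    by (intro continuous_intros continuous_on_compose2[OF f(1)] continuous_on_compose2[OF f(2)]) auto
qed

lemma generator_jointly_measurable:
  assumes "smooth f"
  shows "(\<lambda>(t, \<omega>). generator B S f t (Z t \<omega>)) \<in> borel_measurable (lborel \<Otimes>\<^sub>M M)"
proof -
  have gen: "(\<lambda>(t, z). generator B S f t z) \<in> borel_measurable (borel \<Otimes>\<^sub>M borel)"
    using generator_continuous[OF assms] by (simp add: borel_prod borel_measurable_continuous_onI)
  have "(\<lambda>(t, \<omega>). (t, Z t \<omega>)) \<in> lborel \<Otimes>\<^sub>M M \<rightarrow>\<^sub>M borel \<Otimes>\<^sub>M borel"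
    by measurable
  from measurable_compose[OF this gen] show ?thesis
    by (simp add: case_prod_beta)
qed

lemma generator_measurable:
  assumes "smooth f"
  shows "(\<lambda>\<omega>. generator B S f t (Z t \<omega>)) \<in> borel_measurable M"
  using measurable_compose_Pair1[OF _ generator_jointly_measurable[OF assms], of t]
  by simp

text \<open>The constant is chosen before \<open>f\<close> and \<open>w\<close>; this uniformity is
  what lets all cutoffs, and all regularised powers, share one bound.\<close>

lemma generator_bound:
  obtains C where "C \<ge> 0"
    "\<And>f w t z. weight_for f w \<Longrightarrow> t \<in> {0..T} \<Longrightarrow> \<bar>generator B S f t z\<bar> \<le> C * w z"
proof -
  obtain C where C: "\<And>t z. t \<in> {0..T} \<Longrightarrow> \<bar>B t z\<bar> \<le> C * (1 + \<bar>z\<bar>) \<and> \<bar>S t z\<bar> \<le> C * (1 + z\<^sup>2)"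
    using growth by blast
  define D where "D = max 0 C"
  have D: "\<bar>B t z\<bar> \<le> D * (1 + \<bar>z\<bar>)" "\<bar>S t z\<bar> \<le> D * (1 + z\<^sup>2)" "D \<ge> 0" if "t \<in> {0..T}" for t z
    using C[OF that, of z] mult_right_mono[of C D "1 + \<bar>z\<bar>"] mult_right_mono[of C D "1 + z\<^sup>2"]
    by (auto simp: D_def)
  show ?thesis
  proof (rule that[of "2 * D"])
    show "\<bar>generator B S f t z\<bar> \<le> 2 * D * w z" if w: "weight_for f w" and t: "t \<in> {0..T}" for f w t z
    proof -
      have "\<bar>B t z * deriv f z\<bar> \<le> D * (1 + \<bar>z\<bar>) * \<bar>deriv f z\<bar>"
        unfolding abs_mult using D t by (intro mult_right_mono) auto
      also have "\<dots> \<le> D * w z"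
        using w D(3)[OF t] unfolding mult.assoc weight_for_def by (intro mult_left_mono) auto
      finally have 1: "\<bar>B t z * deriv f z\<bar> \<le> D * w z" .
      have "\<bar>S t z * deriv (deriv f) z\<bar> \<le> D * (1 + z\<^sup>2) * \<bar>deriv (deriv f) z\<bar>"
        unfolding abs_mult using D t by (intro mult_right_mono) auto
      also have "\<dots> \<le> D * w z"
        using w D(3)[OF t] unfolding mult.assoc weight_for_def by (intro mult_left_mono) auto
      finally have 2: "\<bar>S t z * deriv (deriv f) z\<bar> \<le> D * w z" .
      show ?thesis
        using 1 2 unfolding generator_def by (simp add: abs_if split: if_splits)
    qed
  qed (simp add: D_def)
qed

text \<open>With a plateau time function the martingale becomes \<open>X\<close>. Integrating its
  increment over \<open>A\<close> and exchanging time integral and expectation gives the formula;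
  the generator of \<open>f\<close> is bounded on the time interval.\<close>

lemma dynkin_compact_support:
  assumes f: "smooth f" "\<And>x. \<bar>x\<bar> > R \<Longrightarrow> f x = 0" and st: "0 \<le> s" "s \<le> t" and A: "A \<in> sets (F s)"
  shows "((\<lambda>r. LINT \<omega>:A|M. generator B S f r (Z r \<omega>)) has_integral
      ((LINT \<omega>:A|M. f (Z t \<omega>)) - (LINT \<omega>:A|M. f (Z s \<omega>)))) {s..t}"
proof -
  define G where "G = (\<lambda>r \<omega>. generator B S f r (Z r \<omega>))"
  have AM [measurable]: "A \<in> sets M"
    using A subalgebra_F unfolding subalgebra_def by blast
  have [measurable]: "f \<in> borel_measurable borel"
    using f(1) by (intro borel_measurable_continuous_onI smooth_imp_continuous_on)
  obtain K where K: "weight_for f (\<lambda>_. K)"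
    using weight_for_compact_support[OF f] .
  obtain C where C: "\<And>f w r z. weight_for f w \<Longrightarrow> r \<in> {0..t} \<Longrightarrow> \<bar>generator B S f r z\<bar> \<le> C * w z"
    using generator_bound by metis
  have G_joint [measurable]: "(\<lambda>(r, \<omega>). G r \<omega>) \<in> borel_measurable (lborel \<Otimes>\<^sub>M M)"
    unfolding G_def using generator_jointly_measurable[OF f(1)] .
  have G_cont: "continuous_on X (\<lambda>r. G r \<omega>)" if "\<omega> \<in> space M" for \<omega> X
  proof -
    have "continuous_on X (\<lambda>r. (r, Z r \<omega>))"
      by (intro continuous_intros continuous_on_subset[OF Z_continuous[OF that]]) auto
    from continuous_on_compose2[OF generator_continuous[OF f(1)] this] show ?thesis
      by (simp add: G_def)
  qed
  have f_int: "integrable M (\<lambda>\<omega>. f (Z r \<omega>))" for r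
    using K by (intro integrable_const_bound[of _ K]) (auto simp: weight_for_def)
  have G_LINT: "(LINT r:{a..b}|lborel. G r \<omega>) = integral {a..b} (\<lambda>r. G r \<omega>)" if "\<omega> \<in> space M" for \<omega> a b
    by (intro set_borel_integral_eq_integral borel_integrable_atLeastAtMost' G_cont that)
  define X where "X = (\<lambda>r \<omega>. f (Z r \<omega>) - (LINT r':{0..r}|lborel. G r' \<omega>))"
  have "(LINT \<omega>:A|M. X t \<omega>) = (LINT \<omega>:A|M. X s \<omega>) \<and> integrable M (X t) \<and> integrable M (X s)"
  proof -
    obtain \<tau> \<tau>' where \<tau>: "C1c_with_deriv \<tau> \<tau>'" "\<And>r. r \<le> t \<Longrightarrow> \<tau> r = 1" "\<And>r. r \<le> t \<Longrightarrow> \<tau>' r = 0"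
      using C1c_plateau[of t] by metis
    define Y where "Y = (\<lambda>t \<omega>. \<tau> t * f (Z t \<omega>) -
          (LINT s:{0..t}|lborel.
             \<tau> s * (B s (Z s \<omega>) * deriv f (Z s \<omega>) + 1/2 * S s (Z s \<omega>) * deriv (deriv f) (Z s \<omega>))
             + \<tau>' s * f (Z s \<omega>)))"
    have "smooth_compact_support f"
      using f by (rule smooth_imp_smooth_compact_support)
    then have Y: "martingale_on M F {0..} Y"
      using solves \<tau>(1) unfolding solves_martingale_problem_def Y_def by blast
    have "Y r = X r" if "r \<le> t" for r
      using that \<tau>(2,3) unfolding Y_def X_def G_def generator_def
      by (auto simp: fun_eq_iff intro!: set_lebesgue_integral_cong)
    moreover have "(LINT \<omega>:A|M. Y t \<omega>) = (LINT \<omega>:A|M. Y s \<omega>)"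
      using st A by (intro martingale_on_set_integral_eq[OF filtered_prob_space_axioms Y]) auto
    moreover have "integrable M (Y t)" "integrable M (Y s)"
      using Y st by (auto simp: martingale_on_def)
    ultimately show ?thesis using st by auto
  qed
  then have X: "(LINT \<omega>:A|M. X t \<omega>) = (LINT \<omega>:A|M. X s \<omega>)" "integrable M (X t)" "integrable M (X s)"
    by auto
  have set_int: "set_integrable M A g" if "integrable M g" for g :: "'a \<Rightarrow> real"
    using that unfolding set_integrable_def by (intro integrable_mult_indicator) auto
  \<comment> \<open>Subtracting \<open>X\<close>, whose integrals over \<open>A\<close> at times s
    and t agree, leaves only the time integral of the generator.\<close>
  have "(LINT \<omega>:A|M. f (Z t \<omega>)) - (LINT \<omega>:A|M. f (Z s \<omega>))
      = (LINT \<omega>:A|M. f (Z t \<omega>) - X t \<omega>) - (LINT \<omega>:A|M. f (Z s \<omega>) - X s \<omega>)"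
    using X f_int by (simp add: set_int)
  also have "\<dots> = (LINT \<omega>:A|M. (f (Z t \<omega>) - X t \<omega>) - (f (Z s \<omega>) - X s \<omega>))"
    using X f_int by (intro set_integral_diff(2)[symmetric] set_int Bochner_Integration.integrable_diff)
  also have "\<dots> = (LINT \<omega>|M. LINT r|lborel. indicator {s..t} r * indicator A \<omega> * G r \<omega>)"
    unfolding set_lebesgue_integral_def[of M]
  proof (rule Bochner_Integration.integral_cong[OF refl])
    fix \<omega> assume \<omega>: "\<omega> \<in> space M"
    have "(\<lambda>r. G r \<omega>) integrable_on {0..t}"
      by (intro integrable_continuous_real G_cont \<omega>)
    then have "integral {0..s} (\<lambda>r. G r \<omega>) + integral {s..t} (\<lambda>r. G r \<omega>) = integral {0..t} (\<lambda>r. G r \<omega>)"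
      using st by (intro Henstock_Kurzweil_Integration.integral_combine) auto
    then have "f (Z t \<omega>) - X t \<omega> - (f (Z s \<omega>) - X s \<omega>) = (LINT r:{s..t}|lborel. G r \<omega>)"
      using G_LINT[OF \<omega>] by (simp add: X_def)
    also have "indicator A \<omega> *\<^sub>R \<dots> = (LINT r|lborel. indicator {s..t} r * indicator A \<omega> * G r \<omega>)"
      unfolding set_lebesgue_integral_def
      by (simp flip: integral_mult_right_zero add: mult_ac)
    finally show "indicator A \<omega> *\<^sub>R (f (Z t \<omega>) - X t \<omega> - (f (Z s \<omega>) - X s \<omega>)) =
        (LINT r|lborel. indicator {s..t} r * indicator A \<omega> * G r \<omega>)" .
  qed
  finally have eq: "(LINT \<omega>:A|M. f (Z t \<omega>)) - (LINT \<omega>:A|M. f (Z s \<omega>)) =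
      (LINT \<omega>|M. LINT r|lborel. indicator {s..t} r * indicator A \<omega> * G r \<omega>)" .
  interpret pair: pair_sigma_finite lborel M ..
  \<comment> \<open>Fubini's theorem applies because the integrand is bounded by C K and supported
    in a rectangle of finite measure.\<close>
  have int: "integrable (lborel \<Otimes>\<^sub>M M) (\<lambda>(r, \<omega>). indicator {s..t} r * indicator A \<omega> * G r \<omega>)"
  proof (rule integrableI_bounded_set[where A = "{s..t} \<times> space M" and B = "C * K"])
    show "emeasure (lborel \<Otimes>\<^sub>M M) ({s..t} \<times> space M) < \<infinity>"
      using st by (simp add: emeasure_pair_measure_Times emeasure_space_1)
    show "AE x in lborel \<Otimes>\<^sub>M M. x \<in> {s..t} \<times> space M \<longrightarrow>
        norm (case x of (r, \<omega>) \<Rightarrow> indicator {s..t} r * indicator A \<omega> * G r \<omega>) \<le> C * K"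
    proof (intro AE_I2 impI)
      fix x assume "x \<in> {s..t} \<times> space M"
      then obtain r \<omega> where x: "x = (r, \<omega>)" "r \<in> {0..t}" using st by auto
      have "\<bar>G r \<omega>\<bar> \<le> C * K" using C[OF K x(2)] by (simp add: G_def)
      then show "norm (case x of (r, \<omega>) \<Rightarrow> indicator {s..t} r * indicator A \<omega> * G r \<omega>) \<le> C * K"
        by (auto simp: x split: split_indicator)
    qed
  qed (auto simp: space_pair_measure indicator_eq_0_iff intro!: AE_I2)
  have h: "(\<lambda>r. LINT \<omega>|M. indicator {s..t} r * indicator A \<omega> * G r \<omega>)
      = (\<lambda>r. indicator {s..t} r *\<^sub>R (LINT \<omega>:A|M. G r \<omega>))"
    unfolding set_lebesgue_integral_def by (simp add: mult.assoc)
  have "integrable lborel (\<lambda>r. LINT \<omega>|M. indicator {s..t} r * indicator A \<omega> * G r \<omega>)"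
    using pair.integrable_fst'[OF int] by simp
  then have "set_integrable lborel {s..t} (\<lambda>r. LINT \<omega>:A|M. G r \<omega>)"
    unfolding set_integrable_def h .
  from set_borel_integral_eq_integral[OF this]
  have "((\<lambda>r. LINT \<omega>:A|M. G r \<omega>) has_integral (LINT r:{s..t}|lborel. LINT \<omega>:A|M. G r \<omega>)) {s..t}"
    by (simp add: has_integral_integral)
  also have "(LINT r:{s..t}|lborel. LINT \<omega>:A|M. G r \<omega>) =
      (LINT r|lborel. LINT \<omega>|M. indicator {s..t} r * indicator A \<omega> * G r \<omega>)"
    unfolding h by (simp add: set_lebesgue_integral_def)
  also have "\<dots> = (LINT \<omega>|M. LINT r|lborel. indicator {s..t} r * indicator A \<omega> * G r \<omega>)"
    using pair.Fubini_integral[OF int] by simp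
  finally show ?thesis unfolding eq by (simp add: G_def)
qed

end

section \<open>Weights of regularised squares and of monomials\<close>

text \<open>The function is bounded for each fixed \<open>e\<close>, yet the constant 6 does not
  depend on \<open>e\<close>; this independence survives the limit e \<rightarrow> 0.\<close>

lemma weight_for_regularised_square:
  assumes e: "0 < e" "e \<le> 1"
  defines "q \<equiv> \<lambda>z::real. (1 + z\<^sup>2) * inverse (1 + e * z\<^sup>2)"
  shows "smooth q" "weight_for q (\<lambda>z. 6 * q z)"
proof -
  have pos: "1 + e * z\<^sup>2 \<ge> 1" for z :: real
    using e by simp
  then have pos': "1 + e * z\<^sup>2 > 0" "1 + e * z\<^sup>2 \<noteq> 0" for z :: real
    using pos[of z] by linarith+
  show "smooth q"
    unfolding q_def by (intro smooth_intros) (use pos' in auto)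
  have d1: "deriv q = (\<lambda>z. 2 * (1 - e) * z / (1 + e * z\<^sup>2)\<^sup>2)"
    unfolding q_def
    by (rule ext, rule DERIV_imp_deriv)
       (use pos' in \<open>auto intro!: derivative_eq_intros simp: field_simps power2_eq_square\<close>)
  have d2: "deriv (deriv q) = (\<lambda>z. 2 * (1 - e) * (1 - 3 * (e * z\<^sup>2)) / (1 + e * z\<^sup>2) ^ 3)"
    unfolding d1
    by (rule ext, rule DERIV_imp_deriv)
       (use pos' in \<open>auto intro!: derivative_eq_intros simp: divide_simps, simp add: algebra_simps power2_eq_square power3_eq_cube power4_eq_xxxx\<close>)
  have shrink: "x / (1 + e * z\<^sup>2)\<^sup>2 \<le> x / (1 + e * z\<^sup>2)" if "x \<ge> 0" for x z :: real
    using that pos[of z] pos'[of z] by (intro divide_left_mono) (auto simp: power2_eq_square)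
  show "weight_for q (\<lambda>z. 6 * q z)"
    unfolding weight_for_def
  proof (intro allI conjI)
    fix z :: real
    define p where "p = 1 + e * z\<^sup>2"
    have p: "p \<ge> 1" using pos p_def by simp
    have q: "q z = (1 + z\<^sup>2) / p" by (simp add: q_def p_def divide_inverse)
    then have q0: "q z \<ge> 0" using p by simp
    then show "\<bar>q z\<bar> \<le> 6 * q z" by simp
    have "(1 + \<bar>z\<bar>) * (2 * \<bar>1 - e\<bar> * \<bar>z\<bar>) \<le> (1 + \<bar>z\<bar>) * (2 * 1 * \<bar>z\<bar>)"
      using e by (intro mult_left_mono mult_right_mono) auto
    \<comment> \<open>The left side is 2 |z| + 2 z^2, and 2 |z| \<le> 1 + z^2.\<close>
    also have "\<dots> \<le> 3 * (1 + z\<^sup>2)"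
      using sum_squares_ge_zero[of "\<bar>z\<bar> - 1" 0] by (simp add: algebra_simps power2_eq_square)
    finally have "(1 + \<bar>z\<bar>) * (2 * \<bar>1 - e\<bar> * \<bar>z\<bar>) / p\<^sup>2 \<le> 3 * (1 + z\<^sup>2) / p\<^sup>2"
      by (rule divide_right_mono) simp
    also have "\<dots> \<le> 3 * (1 + z\<^sup>2) / p"
      unfolding p_def by (rule shrink) simp
    also have "\<dots> = 3 * q z" by (simp add: q)
    also have "\<dots> \<le> 6 * q z" using q0 by simp
    finally show "(1 + \<bar>z\<bar>) * \<bar>deriv q z\<bar> \<le> 6 * q z"
      unfolding d1 p_def[symmetric]
      by (simp only: abs_mult abs_divide abs_numeral abs_power2 times_divide_eq_right)
    \<comment> \<open>One of the three powers of \<open>p\<close> in the denominator is spent on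
      this factor; the constant 6 is 2 * 3.\<close>
    have "\<bar>1 - 3 * (e * z\<^sup>2)\<bar> \<le> 3 * p"
      using e unfolding p_def by (simp add: abs_le_iff)
    then have "(1 + z\<^sup>2) * (2 * \<bar>1 - e\<bar> * \<bar>1 - 3 * (e * z\<^sup>2)\<bar>) \<le> (1 + z\<^sup>2) * (2 * 1 * (3 * p))"
      using e by (intro mult_left_mono mult_mono) auto
    then have "(1 + z\<^sup>2) * (2 * \<bar>1 - e\<bar> * \<bar>1 - 3 * (e * z\<^sup>2)\<bar>) / p ^ 3 \<le> (1 + z\<^sup>2) * (2 * 1 * (3 * p)) / p ^ 3"
      by (rule divide_right_mono) (use p in simp)
    also have "\<dots> = 6 * (1 + z\<^sup>2) / p\<^sup>2"
      using p by (simp add: power2_eq_square power3_eq_cube)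
    also have "\<dots> \<le> 6 * (1 + z\<^sup>2) / p"
      unfolding p_def by (rule shrink) simp
    also have "\<dots> = 6 * q z" by (simp add: q)
    also have "p ^ 3 = \<bar>p ^ 3\<bar>" using p by simp
    finally show "(1 + z\<^sup>2) * \<bar>deriv (deriv q) z\<bar> \<le> 6 * q z"
      unfolding d2 p_def[symmetric]
      by (simp only: abs_mult abs_divide abs_numeral times_divide_eq_right)
  qed
qed

text \<open>The identity has weight 2 (1 + z^2), and \<open>weight_for_power\<close> turns 2 into 8
  = 4 * 2. The generous degree 2 k is harmless, since moments of all orders are bounded.\<close>

lemma weight_for_monomial: "weight_for (\<lambda>z. z ^ k) (\<lambda>z. 8 ^ k * (1 + z\<^sup>2) ^ k)"
proof -
  have d: "deriv (\<lambda>z::real. z) = (\<lambda>_. 1)" "deriv (\<lambda>_::real. 1::real) = (\<lambda>_. 0)"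
    by (auto intro!: DERIV_imp_deriv)
  have "\<bar>z\<bar> \<le> 2 * (1 + z\<^sup>2) \<and> (1 + \<bar>z\<bar>) * 1 \<le> 2 * (1 + z\<^sup>2)" for z :: real
  proof -
    have "2 * \<bar>z\<bar> \<le> 1 + z\<^sup>2"
      using sum_squares_ge_zero[of "\<bar>z\<bar> - 1" 0] by (simp add: algebra_simps power2_eq_square)
    then have "\<bar>z\<bar> \<le> 2 * (1 + z\<^sup>2)" "1 + \<bar>z\<bar> \<le> 2 * (1 + z\<^sup>2)"
      using zero_le_power2[of z] unfolding distrib_left by linarith+
    then show ?thesis by simp
  qed
  then have "weight_for (\<lambda>z. z) (\<lambda>z. 2 * (1 + z\<^sup>2))"
    unfolding weight_for_def d by auto
  from weight_for_power[OF smooth_ident this] show ?thesis by simp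
qed

section \<open>Dynkin's formula and moments under polynomial growth\<close>

context continuous_martingale_problem
begin

text \<open>The products of \<open>f\<close> with the cutoffs have compact support and share the
  weight \<open>u\<close>. Dominated convergence is applied twice: to expectations, dominated by
  multiples of \<open>u (Z r)\<close>, and to the time integral, dominated by a constant.\<close>

lemma dynkin:
  assumes f: "smooth f" and w: "weight_for f w"
    and w_int: "\<And>r. r \<in> {0..T} \<Longrightarrow> integrable M (\<lambda>\<omega>. w (Z r \<omega>))"
    and w_le: "\<And>r. r \<in> {0..T} \<Longrightarrow> (LINT \<omega>|M. w (Z r \<omega>)) \<le> W"
    and st: "0 \<le> s" "s \<le> t" "t \<le> T" and A: "A \<in> sets (F s)"
  shows "((\<lambda>r. LINT \<omega>:A|M. generator B S f r (Z r \<omega>)) has_integral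
      ((LINT \<omega>:A|M. f (Z t \<omega>)) - (LINT \<omega>:A|M. f (Z s \<omega>)))) {s..t}"
proof -
  obtain \<eta> :: "nat \<Rightarrow> real \<Rightarrow> real" and K
    where \<eta>: "\<And>n. smooth (\<eta> n)" "\<And>n x. \<bar>x\<bar> > real (Suc n) \<Longrightarrow> \<eta> n x = 0"
      "\<And>n. weight_for (\<eta> n) (\<lambda>_. K)"
      and \<eta>_lim: "\<And>x. (\<lambda>n. \<eta> n x) \<longlonglongrightarrow> 1" "\<And>x. (\<lambda>n. deriv (\<eta> n) x) \<longlonglongrightarrow> 0"
      "\<And>x. (\<lambda>n. deriv (deriv (\<eta> n)) x) \<longlonglongrightarrow> 0"
    by (rule cutoff_sequence) (rule that, assumption+)
  define g where "g = (\<lambda>n x. f x * \<eta> n x)"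
  define u where "u = (\<lambda>x. 4 * (w x * K))"
  have g: "smooth (g n)" "weight_for (g n) u" for n
    unfolding g_def u_def
    by (rule smooth_mult[OF f \<eta>(1)]) (rule weight_for_mult[OF f \<eta>(1) w \<eta>(3)])
  have u_int: "integrable M (\<lambda>\<omega>. u (Z r \<omega>))" if "r \<in> {0..T}" for r
    unfolding u_def using w_int[OF that] by auto
  have K: "K \<ge> 0" using weight_for_nonneg[OF \<eta>(3)] .
  have AM [measurable]: "A \<in> sets M"
    using A subalgebra_F unfolding subalgebra_def by blast
  have [measurable]: "f \<in> borel_measurable borel" "g n \<in> borel_measurable borel" for n
    using f g(1) by (auto intro!: borel_measurable_continuous_onI smooth_imp_continuous_on)
  note [measurable] = generator_measurable[OF f] generator_measurable[OF g(1)]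
  obtain C where C: "C \<ge> 0"
    "\<And>f w r z. weight_for f w \<Longrightarrow> r \<in> {0..T} \<Longrightarrow> \<bar>generator B S f r z\<bar> \<le> C * w z"
    using generator_bound by metis
  define h where "h = (\<lambda>f r. LINT \<omega>:A|M. generator B S f r (Z r \<omega>))"
  have g_lim: "(\<lambda>n. LINT \<omega>:A|M. g n (Z r \<omega>)) \<longlonglongrightarrow> (LINT \<omega>:A|M. f (Z r \<omega>))" if "r \<in> {0..T}" for r
    unfolding set_lebesgue_integral_def
  proof (rule integral_dominated_convergence[where w = "\<lambda>\<omega>. u (Z r \<omega>)"])
    show "AE \<omega> in M. (\<lambda>n. indicator A \<omega> *\<^sub>R g n (Z r \<omega>)) \<longlonglongrightarrow> indicator A \<omega> *\<^sub>R f (Z r \<omega>)"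
      unfolding g_def using tendsto_mult[OF tendsto_const \<eta>_lim(1)]
      by (intro AE_I2 tendsto_intros) fastforce
    have "\<bar>g n z\<bar> \<le> u z" "0 \<le> u z" for n z
      using g(2)[of n] weight_for_nonneg[OF g(2)[of n]] by (auto simp: weight_for_def)
    then show "AE \<omega> in M. norm (indicator A \<omega> *\<^sub>R g n (Z r \<omega>)) \<le> u (Z r \<omega>)" for n
      by (intro AE_I2) (auto split: split_indicator)
  qed (use u_int[OF that] in measurable)
  have gen_le: "norm (indicator A \<omega> *\<^sub>R generator B S (g n) r z) \<le> C * u z" if "r \<in> {0..T}" for n r z \<omega>
    using C(2)[OF g(2) that] C(1) weight_for_nonneg[OF g(2)[of n]] by (auto split: split_indicator)
  have h_lim: "(\<lambda>n. h (g n) r) \<longlonglongrightarrow> h f r" if "r \<in> {0..T}" for r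
    unfolding set_lebesgue_integral_def h_def
  proof (rule integral_dominated_convergence[where w = "\<lambda>\<omega>. C * u (Z r \<omega>)"])
    \<comment> \<open>By the product rule, every term containing a derivative of the cutoff tends to
      0 and the generator of \<open>f\<close> remains.\<close>
    have "(\<lambda>n. generator B S (g n) r z) \<longlonglongrightarrow>
        B r z * (deriv f z * 1 + f z * 0) + 1/2 * S r z * (deriv (deriv f) z * 1 + 2 * (deriv f z * 0) + f z * 0)" for z
      unfolding generator_def g_def smooth_deriv_mult(2)[OF f \<eta>(1)]
      unfolding smooth_deriv_mult(1)[OF f \<eta>(1)]
      by (intro tendsto_intros \<eta>_lim)
    then show "AE \<omega> in M. (\<lambda>n. indicator A \<omega> *\<^sub>R generator B S (g n) r (Z r \<omega>))
        \<longlonglongrightarrow> indicator A \<omega> *\<^sub>R generator B S f r (Z r \<omega>)"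
      by (intro AE_I2 tendsto_intros) (simp add: generator_def)
    show "AE \<omega> in M. norm (indicator A \<omega> *\<^sub>R generator B S (g n) r (Z r \<omega>)) \<le> C * u (Z r \<omega>)" for n
      by (intro AE_I2 gen_le that)
  qed (use u_int[OF that] in \<open>measurable, simp\<close>)
  \<comment> \<open>Uniformity in n and r comes from the bound \<open>W\<close> on the expected
    weight.\<close>
  have h_le: "norm (h (g n) r) \<le> C * (4 * (W * K))" if r: "r \<in> {0..T}" for n r
  proof -
    have "norm (h (g n) r) \<le> (LINT \<omega>|M. norm (indicator A \<omega> *\<^sub>R generator B S (g n) r (Z r \<omega>)))"
      unfolding h_def set_lebesgue_integral_def by (rule integral_norm_bound)
    also have "\<dots> \<le> (LINT \<omega>|M. C * u (Z r \<omega>))"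
      using u_int[OF r] gen_le[OF r] weight_for_nonneg[OF g(2)] C(1)
      by (intro integral_mono') auto
    also have "\<dots> = C * (4 * ((LINT \<omega>|M. w (Z r \<omega>)) * K))"
      by (simp add: u_def)
    also have "\<dots> \<le> C * (4 * (W * K))"
      using w_le[OF r] C(1) K by (intro mult_left_mono mult_right_mono) auto
    finally show ?thesis .
  qed
  have h_int: "(h (g n) has_integral ((LINT \<omega>:A|M. g n (Z t \<omega>)) - (LINT \<omega>:A|M. g n (Z s \<omega>)))) {s..t}" for n
    unfolding h_def
    by (rule dynkin_compact_support[OF g(1) _ st(1,2) A, where R = "real (Suc n)"]) (simp add: g_def \<eta>(2))
  have sub: "{s..t} \<subseteq> {0..T}" using st by auto
  have 1: "h f integrable_on {s..t}" "(\<lambda>n. integral {s..t} (h (g n))) \<longlonglongrightarrow> integral {s..t} (h f)"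
    using dominated_convergence[of "\<lambda>n. h (g n)" "{s..t}" "\<lambda>_. C * (4 * (W * K))" "h f"]
      has_integral_integrable[OF h_int] integrable_const_ivl h_le h_lim sub by blast+
  have "(\<lambda>n. integral {s..t} (h (g n))) \<longlonglongrightarrow> (LINT \<omega>:A|M. f (Z t \<omega>)) - (LINT \<omega>:A|M. f (Z s \<omega>))"
    unfolding integral_unique[OF h_int] using st by (intro tendsto_diff g_lim) auto
  with 1(2) have "integral {s..t} (h f) = (LINT \<omega>:A|M. f (Z t \<omega>)) - (LINT \<omega>:A|M. f (Z s \<omega>))"
    by (rule LIMSEQ_unique)
  then show ?thesis
    using 1(1) unfolding h_def by (metis integrable_integral)
qed

text \<open>
  The functions \<open>((1 + z^2) / (1 + \<epsilon> z^2))^k\<close> are bounded, hence admissible in \<open>dynkin\<close> with a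
  constant weight, and increase to \<open>(1 + z^2)^k\<close> as \<open>\<epsilon>\<close> decreases to \<open>0\<close>. They dominate their own
  generator with a constant independent of \<open>\<epsilon>\<close>, so Gronwall's inequality bounds their
  expectations uniformly.
\<close>

lemma moments_bounded:
  obtains W where "\<And>t. t \<in> {0..T} \<Longrightarrow> integrable M (\<lambda>\<omega>. (1 + (Z t \<omega>)\<^sup>2) ^ k)"
    "\<And>t. t \<in> {0..T} \<Longrightarrow> (LINT \<omega>|M. (1 + (Z t \<omega>)\<^sup>2) ^ k) \<le> W"
proof -
  define q where "q = (\<lambda>e z::real. (1 + z\<^sup>2) * inverse (1 + e * z\<^sup>2))"
  obtain C where C: "C \<ge> 0"
    "\<And>f w r z. weight_for f w \<Longrightarrow> r \<in> {0..T} \<Longrightarrow> \<bar>generator B S f r z\<bar> \<le> C * w z"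
    using generator_bound by metis
  \<comment> \<open>The base 24 = 4 * 6 combines the weight constant 6 of the regularised square
    with the factor 4 per multiplication. \<open>W\<close> is Gronwall's bound for this rate,
    started from the e-independent majorant (1 + z0^2)^k.\<close>
  define D where "D = C * 24 ^ k"
  have D: "D \<ge> 0" using C(1) by (simp add: D_def)
  define W where "W = (1 + z0\<^sup>2) ^ k * exp (D * T)"
  have q_nonneg: "0 \<le> q e z" if "0 < e" for e z
    using that by (simp add: q_def)
  have q_le: "q e z \<le> 1 + z\<^sup>2" "q e z \<le> 1 / e" if "0 < e" "e \<le> 1" for e z
  proof -
    have p: "1 \<le> 1 + e * z\<^sup>2" using that by simp
    then have p0: "0 < 1 + e * z\<^sup>2" by linarith
    have "(1 + z\<^sup>2) * 1 \<le> (1 + z\<^sup>2) * (1 + e * z\<^sup>2)" using p by (intro mult_left_mono) auto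
    then show "q e z \<le> 1 + z\<^sup>2" using p0 by (simp add: q_def field_simps)
    show "q e z \<le> 1 / e" using that p0 by (simp add: q_def field_simps)
  qed
  have [measurable]: "(\<lambda>z. q e z ^ k) \<in> borel_measurable borel" for e
    unfolding q_def by measurable
  have bound: "integrable M (\<lambda>\<omega>. q e (Z t \<omega>) ^ k) \<and> (LINT \<omega>|M. q e (Z t \<omega>) ^ k) \<le> W"
    if e: "0 < e" "e \<le> 1" and t: "t \<in> {0..T}" for e t
  proof -
    define f where "f = (\<lambda>z. q e z ^ k)"
    have f: "smooth f" "weight_for f (\<lambda>z. 24 ^ k * q e z ^ k)"
      using smooth_power[OF weight_for_regularised_square(1)[OF e]]
        weight_for_power[OF weight_for_regularised_square[OF e], of k]
      unfolding f_def q_def by (auto simp: power_mult_distrib)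
    have fint: "integrable M (\<lambda>\<omega>. f (Z r \<omega>))" for r
      unfolding f_def using q_nonneg[OF e(1)] q_le(2)[OF e]
      by (intro integrable_const_bound[of _ "(1 / e) ^ k"]) (auto simp: power_mono)
    \<comment> \<open>This constant weight blows up as e \<rightarrow> 0, but it only serves to make
      Dynkin's formula applicable; the Gronwall rate \<open>D\<close> comes from the sharper weight
      in \<open>f\<close>.\<close>
    have "24 ^ k * q e z ^ k \<le> 24 ^ k * (1 / e) ^ k" for z
      using q_nonneg[OF e(1)] q_le(2)[OF e] by (intro mult_left_mono power_mono) auto
    then have f_bdd: "weight_for f (\<lambda>_. 24 ^ k * (1 / e) ^ k)"
      using f(2) unfolding weight_for_def by (meson order_trans)
    \<comment> \<open>The whole space is an event of \<open>F 0\<close>, so Dynkin's formula on it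
      concerns full expectations.\<close>
    define m where "m = (\<lambda>r. LINT \<omega>:space M|M. f (Z r \<omega>))"
    define h where "h = (\<lambda>r. LINT \<omega>:space M|M. generator B S f r (Z r \<omega>))"
    have m: "m r = (LINT \<omega>|M. f (Z r \<omega>))" for r
      using fint by (simp add: m_def set_integral_space)
    have h: "(h has_integral (m r - m 0)) {0..r}" if "r \<in> {0..T}" for r
      unfolding h_def m_def
      using that space_F[of 0] sets.top[of "F 0"]
      by (intro dynkin[OF f(1) f_bdd, where T = T and W = "24 ^ k * (1 / e) ^ k"]) (auto simp: prob_space)
    have h_le: "h r \<le> D * m r" if r: "r \<in> {0..T}" for r
    proof -
      have "h r = (LINT \<omega>|M. indicator (space M) \<omega> *\<^sub>R generator B S f r (Z r \<omega>))"
        by (simp add: h_def set_lebesgue_integral_def)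
      also have "\<dots> \<le> (LINT \<omega>|M. D * f (Z r \<omega>))"
      proof (rule integral_mono')
        show "indicator (space M) \<omega> *\<^sub>R generator B S f r (Z r \<omega>) \<le> D * f (Z r \<omega>)" if "\<omega> \<in> space M" for \<omega>
          using that C(2)[OF f(2) r, of "Z r \<omega>"] by (simp add: D_def f_def)
        show "0 \<le> D * f (Z r \<omega>)" for \<omega>
          using C(1) q_nonneg[OF e(1)] by (simp add: D_def f_def)
      qed (use fint in auto)
      finally show ?thesis by (simp add: m)
    qed
    have "m t \<le> m 0 * exp (D * t)"
      by (rule gronwall_integral[OF h h_le D t])
    also have "m 0 = f z0"
    proof -
      have "AE \<omega> in M. Z 0 \<omega> = z0"
        using solves by (simp add: solves_martingale_problem_def)
      then have "AE \<omega> in M. f (Z 0 \<omega>) = f z0"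
        by eventually_elim simp
      then have "(LINT \<omega>|M. f (Z 0 \<omega>)) = (LINT \<omega>|M. f z0)"
        using fint[of 0] by (intro integral_cong_AE) auto
      then show ?thesis by (simp add: m prob_space)
    qed
    also have "f z0 * exp (D * t) \<le> W"
      unfolding f_def W_def using q_nonneg[OF e(1)] q_le(1)[OF e] t C(1)
      by (intro mult_mono power_mono) (auto simp: D_def intro!: mult_left_mono)
    finally show ?thesis using fint unfolding m f_def by auto
  qed
  define e where "e = (\<lambda>n. inverse (real (Suc n)))"
  have e: "0 < e n" "e n \<le> 1" for n
    by (auto simp: e_def field_simps)
  have e_lim: "e \<longlonglongrightarrow> 0"
    unfolding e_def by (rule LIMSEQ_inverse_real_of_nat)
  have e_mono: "e (Suc n) \<le> e n" for n
    by (simp add: e_def field_simps)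
  have mono: "mono (\<lambda>n. q (e n) z ^ k)" for z
  proof (rule incseq_SucI)
    have "q (e n) z \<le> q (e (Suc n)) z" for n
      unfolding q_def using e[of "Suc n"] e_mono[of n]
      by (intro mult_left_mono le_imp_inverse_le add_left_mono mult_right_mono) (auto intro: add_pos_nonneg)
    then show "q (e n) z ^ k \<le> q (e (Suc n)) z ^ k" for n
      using q_nonneg e by (intro power_mono) auto
  qed
  have lim: "(\<lambda>n. q (e n) z ^ k) \<longlonglongrightarrow> (1 + z\<^sup>2) ^ k" for z
  proof -
    have "(\<lambda>n. q (e n) z ^ k) \<longlonglongrightarrow> ((1 + z\<^sup>2) * inverse (1 + 0 * z\<^sup>2)) ^ k"
      unfolding q_def by (intro tendsto_intros e_lim) auto
    then show ?thesis by simp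
  qed
  \<comment> \<open>Monotone convergence along e = 1 / (n + 1) yields integrability together with
    the bound.\<close>
  have "integrable M (\<lambda>\<omega>. (1 + (Z t \<omega>)\<^sup>2) ^ k) \<and> (LINT \<omega>|M. (1 + (Z t \<omega>)\<^sup>2) ^ k) \<le> W" if t: "t \<in> {0..T}" for t
  proof -
    define I where "I = (\<lambda>n. LINT \<omega>|M. q (e n) (Z t \<omega>) ^ k)"
    have "incseq I"
      unfolding I_def using bound[OF e t] mono
      by (intro incseq_SucI integral_mono) (auto simp: incseq_Suc_iff)
    moreover have "I n \<le> W" for n
      using bound[OF e t] by (simp add: I_def)
    ultimately obtain L where L: "I \<longlonglongrightarrow> L" "\<And>n. I n \<le> L"
      using incseq_convergent by metis
    have "L \<le> W"
      using \<open>\<And>n. I n \<le> W\<close> by (intro LIMSEQ_le_const2[OF L(1)]) auto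
    have int: "integrable M (\<lambda>\<omega>. q (e n) (Z t \<omega>) ^ k)" for n
      using bound[OF e t] by blast
    have AE_mono: "AE \<omega> in M. mono (\<lambda>n. q (e n) (Z t \<omega>) ^ k)"
      using mono by simp
    have AE_lim: "AE \<omega> in M. (\<lambda>n. q (e n) (Z t \<omega>) ^ k) \<longlonglongrightarrow> (1 + (Z t \<omega>)\<^sup>2) ^ k"
      using lim by simp
    have "(\<lambda>\<omega>. (1 + (Z t \<omega>)\<^sup>2) ^ k) \<in> borel_measurable M" by measurable
    note conv = int AE_mono AE_lim L(1)[unfolded I_def] this
    have "integrable M (\<lambda>\<omega>. (1 + (Z t \<omega>)\<^sup>2) ^ k)" "(LINT \<omega>|M. (1 + (Z t \<omega>)\<^sup>2) ^ k) = L"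
      by (rule integrable_monotone_convergence[OF conv], rule integral_monotone_convergence[OF conv])
    with \<open>L \<le> W\<close> show ?thesis by simp
  qed
  then show ?thesis using that by blast
qed

lemma dynkin_monomial:
  assumes "0 \<le> s" "s \<le> t" "A \<in> sets (F s)"
  shows "((\<lambda>r. LINT \<omega>:A|M. generator B S (\<lambda>z. z ^ k) r (Z r \<omega>)) has_integral
      ((LINT \<omega>:A|M. Z t \<omega> ^ k) - (LINT \<omega>:A|M. Z s \<omega> ^ k))) {s..t}"
proof -
  obtain W where "\<And>r. r \<in> {0..t} \<Longrightarrow> integrable M (\<lambda>\<omega>. (1 + (Z r \<omega>)\<^sup>2) ^ k)"
    "\<And>r. r \<in> {0..t} \<Longrightarrow> (LINT \<omega>|M. (1 + (Z r \<omega>)\<^sup>2) ^ k) \<le> W"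
    using moments_bounded[of t k] by metis
  then show ?thesis
    using assms
    by (intro dynkin[OF smooth_power[OF smooth_ident] weight_for_monomial, where T = t and W = "8 ^ k * W"]) auto
qed

lemma integrable_monomial:
  assumes "t \<ge> 0"
  shows "integrable M (\<lambda>\<omega>. Z t \<omega> ^ k)"
proof -
  have "integrable M (\<lambda>\<omega>. 8 ^ k * (1 + (Z t \<omega>)\<^sup>2) ^ k)"
    using moments_bounded[of t k] assms by (metis atLeastAtMost_iff integrable_mult_right order_refl)
  then show ?thesis
    by (rule Bochner_Integration.integrable_bound)
       (use weight_for_monomial[of k] in \<open>auto simp: weight_for_def\<close>)
qed

end

section \<open>Duality between moments and the backward equation\<close>

lemma set_integral_sum:
  fixes f :: "'i \<Rightarrow> 'a \<Rightarrow> real"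
  assumes "\<And>i. i \<in> I \<Longrightarrow> set_integrable M A (f i)"
  shows "(LINT x:A|M. \<Sum>i\<in>I. f i x) = (\<Sum>i\<in>I. LINT x:A|M. f i x)"
  using assms unfolding set_integrable_def set_lebesgue_integral_def scaleR_sum_right
  by (rule Bochner_Integration.integral_sum)

context continuous_martingale_problem
begin

text \<open>Column k of \<open>H\<close> expands the generator of z^k, whereas row k drives the
  equation for \<open>C k\<close>. These transposed roles, with the opposite sign, make the two
  evolutions cancel in the pairing.\<close>

lemma martingale_dual_polynomial:
  assumes gen: "\<And>r k z. r \<in> {0..T} \<Longrightarrow> k \<le> N \<Longrightarrow>
      generator B S (\<lambda>z. z ^ k) r z = (\<Sum>l\<le>N. H r l k * z ^ l)"
    and H: "\<And>l k. l \<le> N \<Longrightarrow> k \<le> N \<Longrightarrow> continuous_on {0..T} (\<lambda>r. H r l k)"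
    and C: "\<And>r k. r \<in> {0..T} \<Longrightarrow> k \<le> N \<Longrightarrow>
      (C k has_real_derivative - (\<Sum>l\<le>N. H r k l * C l r)) (at r within {0..T})"
  shows "martingale_on M F {0..T} (\<lambda>t \<omega>. \<Sum>k\<le>N. Z t \<omega> ^ k * C k t)"
proof -
  define X where "X = (\<lambda>t \<omega>. \<Sum>k\<le>N. Z t \<omega> ^ k * C k t)"
  have X_int: "integrable M (X t)" if "t \<ge> 0" for t
    unfolding X_def using integrable_monomial[OF that] by auto
  have X_adapted: "X t \<in> borel_measurable (F t)" if "t \<ge> 0" for t
    unfolding X_def using Z_adapted[OF that] by measurable
  have set_int: "(LINT \<omega>:A|M. X t \<omega>) = (LINT \<omega>:A|M. X s \<omega>)"
    if st: "0 \<le> s" "s \<le> t" "t \<le> T" and A: "A \<in> sets (F s)" for s t A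
  proof -
    have AM: "A \<in> sets M"
      using A subalgebra_F unfolding subalgebra_def by blast
    define m where "m = (\<lambda>k r. LINT \<omega>:A|M. Z r \<omega> ^ k)"
    define h where "h = (\<lambda>k r. \<Sum>l\<le>N. H r l k * m l r)"
    have mono_int: "set_integrable M A (\<lambda>\<omega>. c * Z r \<omega> ^ k)" if "r \<ge> 0" for r k c
      unfolding set_integrable_def using integrable_monomial[OF that] AM
      by (intro integrable_mult_indicator) auto
    have h: "(LINT \<omega>:A|M. generator B S (\<lambda>z. z ^ k) r (Z r \<omega>)) = h k r"
      if "r \<in> {0..T}" "k \<le> N" for r k
      using that mono_int[of r] unfolding gen[OF that] h_def m_def
      by (subst set_integral_sum) auto
    have m_int: "(h k has_integral (m k r - m k s)) {s..r}" if "r \<in> {s..T}" "k \<le> N" for k r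
      unfolding m_def using that st(1) A
      by (intro has_integral_eq[OF _ dynkin_monomial] h) auto
    \<comment> \<open>Regularity is bootstrapped: the integral identity makes \<open>m\<close>
      continuous, hence \<open>h\<close> is continuous, hence the identity can be
      differentiated.\<close>
    have m_cont: "continuous_on {s..T} (m k)" if "k \<le> N" for k
      using m_int[OF _ that] by (rule continuous_on_of_has_integral)
    have h_cont: "continuous_on {s..T} (h k)" if "k \<le> N" for k
      unfolding h_def using st(1) that
      by (intro continuous_intros m_cont continuous_on_subset[OF H]) auto
    have m_deriv: "(m k has_real_derivative h k r) (at r within {s..T})"
      if "r \<in> {s..T}" "k \<le> N" for k r
    proof -
      have "((\<lambda>r. m k s + integral {s..r} (h k)) has_real_derivative 0 + h k r) (at r within {s..T})"
        by (intro derivative_intros integral_has_real_derivative h_cont that)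
      then have "((\<lambda>r. m k s + integral {s..r} (h k)) has_real_derivative h k r) (at r within {s..T})"
        by simp
      then show ?thesis
        by (rule has_field_derivative_transform_within[OF _ zero_less_one that(1)])
           (simp add: integral_unique[OF m_int[OF _ that(2)]])
    qed
    define \<Phi> where "\<Phi> = (\<lambda>r. \<Sum>k\<le>N. m k r * C k r)"
    have "(\<Phi> has_real_derivative 0) (at r within {s..T})" if r: "r \<in> {s..T}" for r
    proof -
      have "(C k has_real_derivative - (\<Sum>l\<le>N. H r k l * C l r)) (at r within {s..T})" if "k \<le> N" for k
        using r st(1) by (intro DERIV_subset[OF C]) (use that in auto)
      then have "(\<Phi> has_real_derivative (\<Sum>k\<le>N. h k r * C k r + (- (\<Sum>l\<le>N. H r k l * C l r)) * m k r))
          (at r within {s..T})"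
        unfolding \<Phi>_def by (intro DERIV_sum DERIV_mult m_deriv r) auto
      \<comment> \<open>Exchanging the two sums moves \<open>H\<close> from the moments to the
        coefficients.\<close>
      moreover have "(\<Sum>k\<le>N. h k r * C k r) = (\<Sum>k\<le>N. (\<Sum>l\<le>N. H r k l * C l r) * m k r)"
        unfolding h_def sum_distrib_right by (subst sum.swap) (simp add: mult_ac)
      ultimately show ?thesis by (simp add: sum_subtractf)
    qed
    then have "\<Phi> t = \<Phi> s"
      using has_field_derivative_zero_constant[of "{s..T}" \<Phi>] st by auto
    moreover have "(LINT \<omega>:A|M. X r \<omega>) = \<Phi> r" if "r \<ge> 0" for r
      unfolding X_def \<Phi>_def m_def using mono_int[OF that]
      by (subst set_integral_sum) (auto simp: mult.commute)
    ultimately show ?thesis using st by simp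
  qed
  have "AE \<omega> in M. real_cond_exp M (F s) (X t) \<omega> = X s \<omega>" if st: "s \<in> {0..T}" "t \<in> {0..T}" "s \<le> t" for s t
  proof -
    interpret finite_measure_subalgebra M "F s"
      by (simp add: finite_measure_subalgebra_def subalgebra_F finite_measure_axioms
          finite_measure_subalgebra_axioms_def)
    \<comment> \<open>An integrable variable measurable for \<open>F s\<close> whose integrals over
      all events of \<open>F s\<close> agree with those of \<open>X t\<close> is its conditional
      expectation.\<close>
    show ?thesis
      using st by (intro real_cond_exp_charact set_int X_int X_adapted) auto
  qed
  then show ?thesis
    unfolding martingale_on_def X_def[symmetric] using X_int X_adapted by auto
qed

end

section \<open>Polynomial diffusions whose coefficients depend on the dual ODE\<close>

lemma generator_monomial:
  assumes "k \<le> N"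
  shows "generator (\<lambda>t z. b (v t) + \<beta> (v t) * z) (\<lambda>t z. a (v t) + \<gamma> (v t) * z + \<Gamma> (v t) * z\<^sup>2)
      (\<lambda>z. z ^ k) t z = (\<Sum>l\<le>N. H_matrix b \<beta> a \<gamma> \<Gamma> (v t) l k * z ^ l)"
proof -
  define p0 where "p0 = real k * \<beta> (v t) + real k * (real k - 1) / 2 * \<Gamma> (v t)"
  define p1 where "p1 = real k * b (v t) + real k * (real k - 1) / 2 * \<gamma> (v t)"
  define p2 where "p2 = real k * (real k - 1) / 2 * a (v t)"
  consider (zero) "k = 0" | (one) "k = 1" | (ge2) j where "k = Suc (Suc j)"
    by (metis One_nat_def not0_implies_Suc)
  note k_cases = this
  \<comment> \<open>For k < 2 truncated subtraction makes some of the indices k, k - 1, k - 2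
    coincide at 0. This is harmless: \<open>p2\<close> vanishes for k < 2, and all three
    coefficients vanish for k = 0.\<close>
  have "H_matrix b \<beta> a \<gamma> \<Gamma> (v t) l k =
      (if l = k then p0 else 0) + (if l = k - 1 then p1 else 0) + (if l = k - 2 then p2 else 0)" for l
    using k_cases by cases (auto simp: H_matrix_def p0_def p1_def p2_def)
  then have sum: "(\<Sum>l\<le>N. H_matrix b \<beta> a \<gamma> \<Gamma> (v t) l k * z ^ l) =
      p0 * z ^ k + p1 * z ^ (k - 1) + p2 * z ^ (k - 2)"
    using assms le_trans[OF diff_le_self assms] by (simp add: distrib_right sum.distrib if_distrib[of "\<lambda>x. x * _"] cong: if_cong)
  have d1: "deriv (\<lambda>z. z ^ k) = (\<lambda>z. real k * z ^ (k - 1))"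
    by (rule ext, rule DERIV_imp_deriv) (auto intro!: derivative_eq_intros)
  have d2: "deriv (deriv (\<lambda>z. z ^ k)) = (\<lambda>z. real k * (real (k - 1) * z ^ (k - 2)))"
    unfolding d1 by (rule ext, rule DERIV_imp_deriv) (auto intro!: derivative_eq_intros simp: numeral_2_eq_2)
  from k_cases show ?thesis
    unfolding sum generator_def d2
    unfolding d1 p0_def p1_def p2_def
    by cases (simp_all add: field_simps power2_eq_square)
qed

section \<open>Consequences of the dual equations\<close>

text \<open>The forward equation makes the columns started at time 0 differentiable in time;
  composing with continuous coefficients then gives functions continuous in time.\<close>

lemma moment_vec_continuous:
  assumes "solves_dual_odes N z0 H c"
  shows "continuous_map (top_of_set {0..}) (Euclidean_space (Suc N)) (moment_vec N z0 c)"
proof -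
  have "continuous_on {0..} (\<lambda>t. c t 0 (unit_vec j) k)" if "j \<le> N" "k \<le> N" for j k
    using assms that unfolding solves_dual_odes_def
    by (intro DERIV_continuous_on) auto
  then have "continuous_map (top_of_set {0..}) (Euclidean_space (Suc N))
      (\<lambda>t i. if i < Suc N then moment_pairing N z0 (c t 0 (unit_vec i)) else 0)"
    unfolding continuous_map_componentwise_Euclidean_space continuous_map_iff_continuous moment_pairing_def
    by (auto intro!: continuous_intros)
  then show ?thesis
    unfolding moment_vec_def[abs_def] less_Suc_eq_le by simp
qed

lemma linear_ext_deriv:
  assumes "solves_dual_odes N z0 H c" "t \<in> {0..T}" "k \<le> N"
  shows "((\<lambda>t. linear_ext N c T t u k) has_real_derivative
      - (\<Sum>l\<le>N. H (moment_vec N z0 c t) k l * linear_ext N c T t u l)) (at t within {0..T})"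
proof -
  have "((\<lambda>t. linear_ext N c T t u k) has_real_derivative
      (\<Sum>i\<le>N. u i * - (\<Sum>l\<le>N. H (moment_vec N z0 c t) k l * c T t (unit_vec i) l))) (at t within {0..T})"
    unfolding linear_ext_def using assms unfolding solves_dual_odes_def
    by (intro DERIV_sum DERIV_cmult) auto
  moreover have "(\<Sum>i\<le>N. u i * (\<Sum>l\<le>N. H (moment_vec N z0 c t) k l * c T t (unit_vec i) l))
      = (\<Sum>l\<le>N. H (moment_vec N z0 c t) k l * linear_ext N c T t u l)"
    unfolding linear_ext_def sum_distrib_left by (subst sum.swap) (simp add: mult_ac)
  ultimately show ?thesis by (simp add: sum_negf)
qed

lemma linear_ext_terminal:
  assumes "solves_dual_odes N z0 H c" "T \<ge> 0" "k \<le> N"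
  shows "linear_ext N c T T u k = u k"
proof -
  have "linear_ext N c T T u k = (\<Sum>i\<le>N. u i * unit_vec i k)"
    unfolding linear_ext_def using assms by (intro sum.cong) (auto simp: solves_dual_odes_def)
  also have "\<dots> = (\<Sum>i\<le>N. if i = k then u i else 0)"
    by (intro sum.cong) (auto simp: unit_vec_def)
  also have "\<dots> = u k" using assms by simp
  finally show ?thesis .
qed

text \<open>The martingale problem only sees times t \<ge> 0, so process and coefficients may be
  replaced by their extensions to the whole time axis.\<close>

lemma solves_martingale_problem_cong:
  assumes "solves_martingale_problem B S z0 M F Z"
    and "\<And>t z. t \<ge> 0 \<Longrightarrow> B' t z = B t z" "\<And>t z. t \<ge> 0 \<Longrightarrow> S' t z = S t z"
    and "\<And>t. t \<ge> 0 \<Longrightarrow> Z' t = Z t"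
  shows "solves_martingale_problem B' S' z0 M F Z'"
proof -
  have eq: "\<tau> t * f (Z' t \<omega>) - (LINT s:{0..t}|lborel.
        \<tau> s * (B' s (Z' s \<omega>) * deriv f (Z' s \<omega>) + 1/2 * S' s (Z' s \<omega>) * deriv (deriv f) (Z' s \<omega>))
        + \<tau>' s * f (Z' s \<omega>))
    = \<tau> t * f (Z t \<omega>) - (LINT s:{0..t}|lborel.
        \<tau> s * (B s (Z s \<omega>) * deriv f (Z s \<omega>) + 1/2 * S s (Z s \<omega>) * deriv (deriv f) (Z s \<omega>))
        + \<tau>' s * f (Z s \<omega>))" if "t \<ge> 0" for \<tau> \<tau>' f t \<omega>
    using that assms(2-4) by (auto intro!: set_lebesgue_integral_cong)
  have mart: "martingale_on M F {0..} X \<longleftrightarrow> martingale_on M F {0..} Y"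
    if "\<And>t \<omega>. t \<ge> 0 \<Longrightarrow> X t \<omega> = Y t \<omega>" for X Y
  proof -
    have "X t = Y t" if "t \<ge> 0" for t using that \<open>\<And>t \<omega>. t \<ge> 0 \<Longrightarrow> X t \<omega> = Y t \<omega>\<close> by auto
    then show ?thesis unfolding martingale_on_def by auto
  qed
  have "continuous_on {0..} (\<lambda>t. Z' t \<omega>) \<longleftrightarrow> continuous_on {0..} (\<lambda>t. Z t \<omega>)" for \<omega>
    using assms(4) by (intro continuous_on_cong) auto
  then show ?thesis
    using assms(1,4) unfolding solves_martingale_problem_def by (subst mart[OF eq]) auto
qed

theorem theorem3p13:
  fixes N :: nat and z0 :: real
    and b \<beta> a \<gamma> \<Gamma> :: "(nat \<Rightarrow> real) \<Rightarrow> real"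
    and c :: "real \<Rightarrow> real \<Rightarrow> (nat \<Rightarrow> real) \<Rightarrow> nat \<Rightarrow> real"
    and v :: "real \<Rightarrow> nat \<Rightarrow> real"
    and B S :: "real \<Rightarrow> real \<Rightarrow> real"
    and M :: "'a measure" and F :: "real \<Rightarrow> 'a measure" and Z :: "real \<Rightarrow> 'a \<Rightarrow> real"
  defines "v \<equiv> moment_vec N z0 c"
    and "B \<equiv> (\<lambda>t z. b (v t) + \<beta> (v t) * z)"
    and "S \<equiv> (\<lambda>t z. a (v t) + \<gamma> (v t) * z + \<Gamma> (v t) * z\<^sup>2)"
  assumes "N \<ge> 1"
    and "continuous_coeff N b" "continuous_coeff N \<beta>"
    and "continuous_coeff N a" "continuous_coeff N \<gamma>" "continuous_coeff N \<Gamma>"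
    and "continuous_flow N c"
    and "martingale_problem_well_posed B S z0"
    and "solves_martingale_problem B S z0 M F Z"
    and "unique_solution_dual_odes N z0 (H_matrix b \<beta> a \<gamma> \<Gamma>) c"
  shows "\<forall>T\<ge>0. \<forall>u\<in>topspace (Euclidean_space (Suc N)).
     martingale_on M F {0..T} (\<lambda>t \<omega>. moment_pairing N (Z t \<omega>) (linear_ext N c T t u)) \<and>
     (\<forall>t\<in>{0..T}.
        (AE \<omega> in M. real_cond_exp M (F t)
             (\<lambda>\<omega>. moment_pairing N (Z T \<omega>) (linear_ext N c T T u)) \<omega>
           = real_cond_exp M (F t) (\<lambda>\<omega>. moment_pairing N (Z T \<omega>) u) \<omega>) \<and>
        (AE \<omega> in M. real_cond_exp M (F t) (\<lambda>\<omega>. moment_pairing N (Z T \<omega>) u) \<omega>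
           = moment_pairing N (Z t \<omega>) (linear_ext N c T t u)))"
proof (intro allI impI ballI)
  fix T :: real and u assume T: "T \<ge> 0" and "u \<in> topspace (Euclidean_space (Suc N))"
  have ode: "solves_dual_odes N z0 (H_matrix b \<beta> a \<gamma> \<Gamma>) c"
    using assms by (simp add: unique_solution_dual_odes_def)
  \<comment> \<open>Freezing everything at time 0 for negative times preserves continuity and meets
    the requirements of \<open>continuous_martingale_problem\<close>.\<close>
  define w where "w = (\<lambda>t. v (max 0 t))"
  define B' where "B' = (\<lambda>t z. b (w t) + \<beta> (w t) * z)"
  define S' where "S' = (\<lambda>t z. a (w t) + \<gamma> (w t) * z + \<Gamma> (w t) * z\<^sup>2)"
  define Z' where "Z' = (\<lambda>t. Z (max 0 t))"
  have coeff_cont: "continuous_on X (\<lambda>t. g (w t))" if "continuous_coeff N g" for g X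
  proof -
    have "continuous_map (top_of_set {0..}) euclideanreal (g \<circ> v)"
      using continuous_map_compose[OF moment_vec_continuous[OF ode]] that
      unfolding v_def continuous_coeff_def by blast
    then have "continuous_on {0..} (\<lambda>t. g (v t))"
      by (simp add: comp_def)
    then show ?thesis
      unfolding w_def by (rule continuous_on_compose2) (auto intro!: continuous_intros)
  qed
  note coeffs = assms(5-9)[THEN coeff_cont]
  have "solves_martingale_problem B' S' z0 M F Z'"
    using assms(12)
    by (rule solves_martingale_problem_cong) (auto simp: B_def S_def B'_def S'_def Z'_def w_def)
  moreover have "\<exists>C. \<forall>t\<in>{0..T}. \<forall>z. \<bar>B' t z\<bar> \<le> C * (1 + \<bar>z\<bar>) \<and> \<bar>S' t z\<bar> \<le> C * (1 + z\<^sup>2)" for T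
  proof -
    \<comment> \<open>Along \<open>w\<close> the coefficients are continuous in time, hence bounded
      on compact intervals; the affine and quadratic dependence on z then gives the growth
      condition.\<close>
    have bdd: "\<exists>K. \<forall>t\<in>{0..T}. \<bar>g (w t)\<bar> \<le> K" if "continuous_coeff N g" for g
      using compact_imp_bounded[OF compact_continuous_image[OF coeff_cont[OF that] compact_Icc]]
      by (auto simp: bounded_iff)
    obtain K1 K2 K3 K4 K5 where K: "\<And>t. t \<in> {0..T} \<Longrightarrow> \<bar>b (w t)\<bar> \<le> K1 \<and> \<bar>\<beta> (w t)\<bar> \<le> K2 \<and>
        \<bar>a (w t)\<bar> \<le> K3 \<and> \<bar>\<gamma> (w t)\<bar> \<le> K4 \<and> \<bar>\<Gamma> (w t)\<bar> \<le> K5"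
      using assms(5-9)[THEN bdd] by metis
    define C where "C = \<bar>K1\<bar> + \<bar>K2\<bar> + \<bar>K3\<bar> + \<bar>K4\<bar> + \<bar>K5\<bar>"
    have "\<bar>B' t z\<bar> \<le> C * (1 + \<bar>z\<bar>) \<and> \<bar>S' t z\<bar> \<le> C * (1 + z\<^sup>2)" if "t \<in> {0..T}" for t z
    proof
      note K = K[OF that]
      have "\<bar>B' t z\<bar> \<le> \<bar>b (w t)\<bar> * 1 + \<bar>\<beta> (w t)\<bar> * \<bar>z\<bar>"
        unfolding B'_def by (simp add: abs_mult[symmetric] abs_triangle_ineq)
      also have "\<dots> \<le> C * 1 + C * \<bar>z\<bar>"
        using K by (intro add_mono mult_right_mono) (auto simp: C_def)
      finally show "\<bar>B' t z\<bar> \<le> C * (1 + \<bar>z\<bar>)" by (simp add: algebra_simps)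
      have z: "\<bar>z\<bar> \<le> 1 + z\<^sup>2"
        using sum_squares_ge_zero[of "\<bar>z\<bar> - 1" 0] zero_le_power2[of z]
        by (simp add: algebra_simps power2_eq_square)
      have "\<bar>S' t z\<bar> \<le> \<bar>a (w t)\<bar> * 1 + \<bar>\<gamma> (w t)\<bar> * \<bar>z\<bar> + \<bar>\<Gamma> (w t)\<bar> * z\<^sup>2"
        unfolding S'_def using abs_triangle_ineq[of "a (w t) + \<gamma> (w t) * z" "\<Gamma> (w t) * z\<^sup>2"]
          abs_triangle_ineq[of "a (w t)" "\<gamma> (w t) * z"] by (simp add: abs_mult)
      also have "\<dots> \<le> \<bar>K3\<bar> * (1 + z\<^sup>2) + \<bar>K4\<bar> * (1 + z\<^sup>2) + \<bar>K5\<bar> * (1 + z\<^sup>2)"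
        using K z by (intro add_mono mult_mono) auto
      also have "\<dots> \<le> C * (1 + z\<^sup>2)"
        unfolding distrib_right[symmetric] by (intro mult_right_mono) (auto simp: C_def)
      finally show "\<bar>S' t z\<bar> \<le> C * (1 + z\<^sup>2)" .
    qed
    then show ?thesis by blast
  qed
  moreover have "continuous_on UNIV (\<lambda>(t, z). B' t z)" "continuous_on UNIV (\<lambda>(t, z). S' t z)"
    unfolding B'_def S'_def case_prod_beta
    by (intro continuous_intros continuous_on_compose2[OF coeffs(1)[of UNIV]]
        continuous_on_compose2[OF coeffs(2)[of UNIV]] continuous_on_compose2[OF coeffs(3)[of UNIV]]
        continuous_on_compose2[OF coeffs(4)[of UNIV]] continuous_on_compose2[OF coeffs(5)[of UNIV]]; simp)+
  ultimately interpret continuous_martingale_problem M F B' S' z0 Z'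
    unfolding continuous_martingale_problem_def continuous_martingale_problem_axioms_def
    by (auto simp: Z'_def solves_martingale_problem_def)
  have "martingale_on M F {0..T} (\<lambda>t \<omega>. \<Sum>k\<le>N. Z' t \<omega> ^ k * linear_ext N c T t u k)"
  proof (rule martingale_dual_polynomial[where H = "\<lambda>t. H_matrix b \<beta> a \<gamma> \<Gamma> (w t)"])
    show "generator B' S' (\<lambda>z. z ^ k) r z = (\<Sum>l\<le>N. H_matrix b \<beta> a \<gamma> \<Gamma> (w r) l k * z ^ l)" if "k \<le> N" for k r z
      unfolding B'_def S'_def using that by (rule generator_monomial)
    \<comment> \<open>The case distinctions in \<open>H_matrix\<close> concern the indices only,
      never the time variable.\<close>
    have if_cont: "continuous_on X (\<lambda>x. if P then f x else g x)"
      if "continuous_on X f" "continuous_on X g" for P X and f g :: "real \<Rightarrow> real"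
      using that by (cases P) auto
    show "continuous_on {0..T} (\<lambda>r. H_matrix b \<beta> a \<gamma> \<Gamma> (w r) l k)" for l k
      unfolding H_matrix_def by (intro if_cont continuous_intros coeffs; simp)
    show "((\<lambda>t. linear_ext N c T t u k) has_real_derivative
        - (\<Sum>l\<le>N. H_matrix b \<beta> a \<gamma> \<Gamma> (w r) k l * linear_ext N c T r u l)) (at r within {0..T})"
      if "r \<in> {0..T}" "k \<le> N" for r k
      using linear_ext_deriv[OF ode that] that by (simp add: w_def v_def)
  qed
  moreover have "Z' t = Z t" if "t \<in> {0..T}" for t
    using that by (simp add: Z'_def)
  ultimately have mart: "martingale_on M F {0..T} (\<lambda>t \<omega>. moment_pairing N (Z t \<omega>) (linear_ext N c T t u))"
    unfolding martingale_on_def moment_pairing_def by auto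
  \<comment> \<open>The condition c(T, T, e_i) = e_i makes the martingale end at the pairing with
    \<open>u\<close>, which turns the martingale property into the conditional moment
    formula.\<close>
  have terminal: "moment_pairing N z (linear_ext N c T T u) = moment_pairing N z u" for z
    unfolding moment_pairing_def using linear_ext_terminal[OF ode T] by (intro sum.cong) auto
  show "martingale_on M F {0..T} (\<lambda>t \<omega>. moment_pairing N (Z t \<omega>) (linear_ext N c T t u)) \<and>
     (\<forall>t\<in>{0..T}.
        (AE \<omega> in M. real_cond_exp M (F t)
             (\<lambda>\<omega>. moment_pairing N (Z T \<omega>) (linear_ext N c T T u)) \<omega>
           = real_cond_exp M (F t) (\<lambda>\<omega>. moment_pairing N (Z T \<omega>) u) \<omega>) \<and>
        (AE \<omega> in M. real_cond_exp M (F t) (\<lambda>\<omega>. moment_pairing N (Z T \<omega>) u) \<omega>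
           = moment_pairing N (Z t \<omega>) (linear_ext N c T t u)))"
  proof (intro conjI ballI mart)
    fix t assume "t \<in> {0..T}"
    then have "AE \<omega> in M. real_cond_exp M (F t) (\<lambda>\<omega>. moment_pairing N (Z T \<omega>) (linear_ext N c T T u)) \<omega>
        = moment_pairing N (Z t \<omega>) (linear_ext N c T t u)"
      using mart T unfolding martingale_on_def by auto
    then show "AE \<omega> in M. real_cond_exp M (F t) (\<lambda>\<omega>. moment_pairing N (Z T \<omega>) u) \<omega>
        = moment_pairing N (Z t \<omega>) (linear_ext N c T t u)"
      unfolding terminal .
  qed (simp add: terminal)
qed

end
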